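(* Fix a constant $0<c<\infty$. There exist constants $0<C_1,C_2<\infty$, which may depend on $c$ but not on $n$, such that for every integer $L\ge 2$ with $n=L^2>c$, the mixing time $\tau_{\mathrm{mix}}$ of the kinetically constrained Ising process (KCIP) on the two-dimensional torus $\Lambda(L,2)$ with density parameter $p=c/n$ satisfies $$C_1\, n^3\;\le\;\tau_{\mathrm{mix}}\;\le\; C_2\, n^3 (\log n)^{14}.$$
   Context: Torus: $\Lambda(L,2)$ is the graph with vertex set $V=\mathbb{Z}_L^2$, two vertices $u,v$ being adjacent iff $u-v\in\{\pm(1,0),\pm(0,1)\}$; $n=|V|=L^2$. KCIP (FA1f process) on a finite connected graph $G=(V,E)$ with parameter $0<p<1$: the discrete-time Markov chain $\{X_t\}$ on the set $\Omega$ of configurations $x\in\{0,1\}^V$ that are not identically $0$, with the following update. At each time $t$, choose (independently of each other and of the past) $v_t$ uniform on $V$ and $p_t$ uniform on $[0,1]$. If there is a neighbour $u$ of $v_t$ with $X_t[u]=1$, set $X_{t+1}[v_t]=1$ if $p_t\le p$ and $X_{t+1}[v_t]=0$ if $p_t>p$. If no such $u$ exists, set $X_{t+1}[v_t]=X_t[v_t]$. In all cases $X_{t+1}[w]=X_t[w]$ for $w\ne v_t$. (A configuration that is not identically $0$ never becomes identically $0$.) Its stationary distribution is $\pi(y)=\frac{1}{1-(1-p)^{n}}\,p^{|y|}(1-p)^{n-|y|}\mathbf 1_{|y|>0}$, where $|y|=\sum_v y[v]$ and $n=|V|$. Mixing time: with $\|\mu-\nu\|_{\mathrm{TV}}=\sup_A(\mu(A)-\nu(A))$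 and $\mathcal L(X)$ the law of $X$, $\tau(\epsilon)=\inf\{t>0:\ \sup_{X_0=x\in\Omega}\|\mathcal L(X_t)-\pi\|_{\mathrm{TV}}<\epsilon\}$ and $\tau_{\mathrm{mix}}=\tau(1/4)$. *)

theory Defs
  imports "HOL-Probability.Probability" "HOL-Number_Theory.Cong"
begin

section \<open>The torus\<close>

text \<open>The group of residues modulo \<open>L\<close> is represented by \<open>{0..<L}\<close>; differences are taken
  modulo \<open>L\<close>. For \<open>L = 2\<close> the residues \<open>1\<close> and \<open>-1\<close> coincide and the graph is a 4-cycle.\<close>

definition torus_verts :: "nat \<Rightarrow> (int \<times> int) set" where
  "torus_verts L = {0..<int L} \<times> {0..<int L}"

definition torus_adj :: "nat \<Rightarrow> int \<times> int \<Rightarrow> int \<times> int \<Rightarrow> bool" where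
  "torus_adj L u v \<longleftrightarrow> u \<in> torus_verts L \<and> v \<in> torus_verts L \<and>
     (\<exists>(a, b) \<in> {(1, 0), (-1, 0), (0, 1), (0, -1)}.
        [fst u - fst v = a] (mod int L) \<and> [snd u - snd v = b] (mod int L))"


section \<open>The kinetically constrained Ising process on a finite graph\<close>

definition kcip_configs :: "'v set \<Rightarrow> ('v \<Rightarrow> nat) set" where
  "kcip_configs V = {x \<in> V \<rightarrow>\<^sub>E {0, 1}. \<exists>v\<in>V. x v \<noteq> 0}"

text \<open>The Boolean \<open>b\<close> is the indicator of the event that the uniform variable on \<open>[0,1]\<close>
  drawn at this step is at most \<open>p\<close>; hence it is Bernoulli with parameter \<open>p\<close>.\<close>

definition kcip_update ::
    "'v set \<Rightarrow> ('v \<Rightarrow> 'v \<Rightarrow> bool) \<Rightarrow> ('v \<Rightarrow> nat) \<Rightarrow> 'v \<Rightarrow> bool \<Rightarrow> ('v \<Rightarrow> nat)" where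
  "kcip_update V adj x v b =
     (if \<exists>u\<in>V. adj u v \<and> x u = 1 then x(v := (if b then 1 else 0)) else x)"

definition kcip_step ::
    "'v set \<Rightarrow> ('v \<Rightarrow> 'v \<Rightarrow> bool) \<Rightarrow> real \<Rightarrow> ('v \<Rightarrow> nat) \<Rightarrow> ('v \<Rightarrow> nat) pmf" where
  "kcip_step V adj p x =
     bind_pmf (pmf_of_set V) (\<lambda>v. map_pmf (kcip_update V adj x v) (bernoulli_pmf p))"

primrec kcip_law ::
    "'v set \<Rightarrow> ('v \<Rightarrow> 'v \<Rightarrow> bool) \<Rightarrow> real \<Rightarrow> ('v \<Rightarrow> nat) \<Rightarrow> nat \<Rightarrow> ('v \<Rightarrow> nat) pmf" where
  "kcip_law V adj p x 0 = return_pmf x"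
| "kcip_law V adj p x (Suc t) = bind_pmf (kcip_law V adj p x t) (kcip_step V adj p)"

definition kcip_density :: "'v set \<Rightarrow> real \<Rightarrow> ('v \<Rightarrow> nat) \<Rightarrow> real" where
  "kcip_density V p y =
     (if y \<in> kcip_configs V
      then 1 / (1 - (1 - p) ^ card V) * p ^ (\<Sum>v\<in>V. y v) * (1 - p) ^ (card V - (\<Sum>v\<in>V. y v))
      else 0)"

text \<open>\<open>embed_pmf\<close> is unspecified unless the density has total mass 1; this is
  \<open>pmf_kcip_stationary\<close> below.\<close>

definition kcip_stationary :: "'v set \<Rightarrow> real \<Rightarrow> ('v \<Rightarrow> nat) pmf" where
  "kcip_stationary V p = embed_pmf (kcip_density V p)"


section \<open>Mixing time\<close>

definition tv_dist :: "'a pmf \<Rightarrow> 'a pmf \<Rightarrow> real" where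
  "tv_dist \<mu> \<nu> = (SUP A. measure_pmf.prob \<mu> A - measure_pmf.prob \<nu> A)"

text \<open>Caveat: the infimum of the empty set of naturals is \<open>0\<close>, whereas every actual value is
  positive. A positive lower bound on the mixing time therefore also asserts that the set is
  nonempty.\<close>

definition kcip_mixing_time_eps ::
    "'v set \<Rightarrow> ('v \<Rightarrow> 'v \<Rightarrow> bool) \<Rightarrow> real \<Rightarrow> real \<Rightarrow> nat" where
  "kcip_mixing_time_eps V adj p \<epsilon> =
     Inf {t. t > 0 \<and>
       (SUP x \<in> kcip_configs V. tv_dist (kcip_law V adj p x t) (kcip_stationary V p)) < \<epsilon>}"

definition kcip_mixing_time :: "'v set \<Rightarrow> ('v \<Rightarrow> 'v \<Rightarrow> bool) \<Rightarrow> real \<Rightarrow> nat" where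
  "kcip_mixing_time V adj p = kcip_mixing_time_eps V adj p (1 / 4)"


section \<open>Basic facts\<close>

lemma finite_torus_verts [simp]: "finite (torus_verts L)"
  by (simp add: torus_verts_def)

lemma torus_adj_irrefl: "L \<ge> 2 \<Longrightarrow> \<not> torus_adj L v v"
  by (auto simp: torus_adj_def cong_iff_dvd_diff zdvd1_eq)

lemma card_torus_verts: "card (torus_verts L) = L ^ 2"
  by (simp add: torus_verts_def card_cartesian_product power2_eq_square)

lemma finite_kcip_configs: "finite V \<Longrightarrow> finite (kcip_configs V)"
  unfolding kcip_configs_def by (rule finite_subset[of _ "V \<rightarrow>\<^sub>E {0, 1}"]) (auto intro: finite_PiE)

lemma kcip_weight_eq_prod:
  fixes p :: real and y :: "'v \<Rightarrow> nat"
  assumes "finite V" and "\<And>v. v \<in> V \<Longrightarrow> y v \<in> {0, 1}"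
  shows "p ^ (\<Sum>v\<in>V. y v) * (1 - p) ^ (card V - (\<Sum>v\<in>V. y v)) =
    (\<Prod>v\<in>V. if y v = 1 then p else 1 - p)"
proof -
  have "(\<Sum>v\<in>V. y v) = (\<Sum>v\<in>V. if y v = 1 then 1 else 0)"
    using assms(2) by (intro sum.cong) auto
  also have "\<dots> = card (V \<inter> {v. y v = 1})"
    using assms(1) by (simp add: sum.If_cases)
  finally have *: "(\<Sum>v\<in>V. y v) = card (V \<inter> {v. y v = 1})" .
  have "card (V \<inter> - {v. y v = 1}) = card V - card (V \<inter> {v. y v = 1})"
    using assms(1) by (metis Diff_eq card_Diff_subset_Int finite_Int)
  thus ?thesis
    using assms(1) by (simp add: * prod.If_cases)
qed

lemma sum_kcip_density:
  fixes p :: real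
  assumes V: "finite V" "V \<noteq> {}" and p: "0 < p" "p < 1"
  shows "(\<Sum>y\<in>kcip_configs V. kcip_density V p y) = 1"
proof -
  define w where "w y = p ^ (\<Sum>v\<in>V. y v) * (1 - p) ^ (card V - (\<Sum>v\<in>V. y v))"
    for y :: "'a \<Rightarrow> nat"
  define z where "z = restrict (\<lambda>_. 0 :: nat) V"
  have "(\<Sum>y\<in>V \<rightarrow>\<^sub>E {0, 1}. w y) =
      (\<Sum>y\<in>V \<rightarrow>\<^sub>E {0, 1::nat}. \<Prod>v\<in>V. if y v = 1 then p else 1 - p)"
    unfolding w_def by (intro sum.cong refl kcip_weight_eq_prod V) auto
  also have "\<dots> = (\<Prod>v\<in>V. \<Sum>b\<in>{0, 1::nat}. if b = 1 then p else 1 - p)"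
    using V by (subst prod_sum_PiE) auto
  also have "\<dots> = 1" by simp
  finally have total: "(\<Sum>y\<in>V \<rightarrow>\<^sub>E {0, 1}. w y) = 1" .
  have split: "V \<rightarrow>\<^sub>E {0, 1} = insert z (kcip_configs V)"
  proof (intro equalityI subsetI)
    fix y :: "'a \<Rightarrow> nat" assume y: "y \<in> V \<rightarrow>\<^sub>E {0, 1}"
    show "y \<in> insert z (kcip_configs V)"
    proof (cases "\<exists>v\<in>V. y v \<noteq> 0")
      case False
      hence "y = z" using y by (intro ext) (auto simp: z_def PiE_def extensional_def)
      thus ?thesis by simp
    qed (use y in \<open>auto simp: kcip_configs_def\<close>)
  next
    fix y assume "y \<in> insert z (kcip_configs V)"
    moreover have "z \<in> V \<rightarrow>\<^sub>E {0, 1}" by (simp add: z_def)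
    ultimately show "y \<in> V \<rightarrow>\<^sub>E {0, 1}" unfolding kcip_configs_def by (elim insertE CollectE conjE) simp_all
  qed
  have "z \<notin> kcip_configs V" by (auto simp: kcip_configs_def z_def)
  hence "w z + (\<Sum>y\<in>kcip_configs V. w y) = 1"
    using total V unfolding split by (simp add: finite_kcip_configs)
  moreover have "w z = (1 - p) ^ card V" by (simp add: w_def z_def)
  ultimately have S: "(\<Sum>y\<in>kcip_configs V. w y) = 1 - (1 - p) ^ card V" by simp
  have "card V > 0" using V by (simp add: card_gt_0_iff)
  hence "(1 - p) ^ card V < 1" using p by (simp add: power_less_one_iff)
  moreover have "(\<Sum>y\<in>kcip_configs V. kcip_density V p y) =
      (\<Sum>y\<in>kcip_configs V. 1 / (1 - (1 - p) ^ card V) * w y)"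
    by (intro sum.cong) (simp_all add: kcip_density_def w_def)
  ultimately show ?thesis by (simp add: S flip: sum_distrib_left sum_divide_distrib)
qed

lemma pmf_kcip_stationary:
  fixes p :: real
  assumes V: "finite V" "V \<noteq> {}" and p: "0 < p" "p < 1"
  shows "pmf (kcip_stationary V p) y = kcip_density V p y"
  unfolding kcip_stationary_def
proof (rule pmf_embed_pmf)
  have "(1 - p) ^ card V \<le> 1" using p by (intro power_le_one) auto
  thus nonneg: "0 \<le> kcip_density V p y" for y
    using p by (simp add: kcip_density_def)
  have "(\<integral>\<^sup>+ y. ennreal (kcip_density V p y) \<partial>count_space UNIV) =
      (\<Sum>y\<in>kcip_configs V. ennreal (kcip_density V p y))"
    using V by (intro nn_integral_count_space'[OF finite_kcip_configs])
      (auto simp: kcip_density_def split: if_splits)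
  also have "\<dots> = 1"
    using sum_kcip_density[OF V p] nonneg by (simp add: sum_ennreal)
  finally show "(\<integral>\<^sup>+ y. ennreal (kcip_density V p y) \<partial>count_space UNIV) = 1" .
qed

lemma set_pmf_kcip_step:
  assumes V: "finite V" "V \<noteq> {}" and irrefl: "\<And>v. \<not> adj v v" and x: "x \<in> kcip_configs V"
  shows "set_pmf (kcip_step V adj p x) \<subseteq> kcip_configs V"
proof -
  have "kcip_update V adj x v b \<in> kcip_configs V" if v: "v \<in> V" for v b
  proof (cases "\<exists>u\<in>V. adj u v \<and> x u = 1")
    case True
    then obtain u where u: "u \<in> V" "adj u v" "x u = 1" by blast
    hence "u \<noteq> v" using irrefl by metis
    hence "\<exists>u\<in>V. (x(v := (if b then 1 else 0))) u \<noteq> 0" using u by (intro bexI[of _ u]) auto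
    moreover have "x(v := (if b then 1 else 0)) \<in> V \<rightarrow>\<^sub>E {0, 1}"
      using x v by (simp add: kcip_configs_def PiE_iff extensional_def)
    ultimately show ?thesis using True unfolding kcip_update_def kcip_configs_def by simp
  next
    case False
    show ?thesis using x unfolding kcip_update_def if_not_P[OF False] .
  qed
  thus ?thesis using V by (auto simp: kcip_step_def)
qed

end

(*
  Upper bound: the one-step kernel is the average over v of conditional expectations, so one step
  lowers the relative entropy Ent(f) by at least (1/n) times the Dirichlet form of sqrt f. The
  unconstrained product measure satisfies a log-Sobolev inequality whose Dirichlet form involves
  all single flips. A flip at v in S is compared with legal moves by letting one extra particle
  wander from a particle u of S to v while S stays frozen; summed over v, this costs n times the
  effective resistance of the torus, hence n log n, and another factor n/c because the extra
  particle has probability p. The empty configuration, missing from the state space, is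
  given the value of a one-particle configuration. The entropy therefore decays at rate
  1/(n^3 log^2 n), and it is at most polynomial in n initially, so time n^3 log^3 n suffices.

  Lower bound: let F be the maximum over the particles of a 1-Lipschitz function, namely the
  distance of the first coordinate to a fixed point. A legal move changes F by at most 1 (an
  average over the particles would not have this property), so the Dirichlet form of F is of
  order 1/n^2, whereas F varies on the scale sqrt n on events of positive probability.
*)
theory Submission
  imports Defs
begin

section \<open>Entropy inequalities\<close>

text \<open>Entropy is tracked rather than variance because the smallest stationary weight is about
  exp(-n ln n). A spectral gap alone would multiply the relaxation time by the logarithm of its
  inverse, an extra factor of order n. Entropy decay pays only for the logarithm of the initial
  entropy.

  The obstacle is that the constraint destroys the product structure: a particle cannot appear far
  from all others. The price is a factor 1/p for the presence of the mover. A second 1/p, from the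
  variance p(1-p) of a flip in the Dirichlet form, is cancelled by the factor p in the log-Sobolev
  constant p(9 + 4 ln(1/p)); a two-point inequality without this p would lose a further power of n.

  Since c is arbitrary, p = c/n need not be small. It stays away from 1 by a margin depending on c
  only, because n is an integer exceeding c.\<close>

lemma xlnx_tangent:
  fixes y m :: real
  assumes "0 \<le> y" "0 < m"
  shows "y * ln m + y - m \<le> y * ln y"
proof (cases "y = 0")
  case False
  with assms have y: "0 < y" by simp
  have "ln (m / y) \<le> m / y - 1" using y assms by (intro ln_le_minus_one) simp
  hence "y * (ln m - ln y) \<le> y * (m / y - 1)"
    using y assms by (intro mult_left_mono) (simp_all add: ln_div)
  thus ?thesis using y by (simp add: algebra_simps)
qed (use assms in simp)

text \<open>This is \<open>ln x <= x - 1\<close> at \<open>sqrt (m / y)\<close> instead of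
  \<open>m / y\<close>. Halving the logarithm brings in square roots, as needed to compare entropy
  with the variance of \<open>sqrt f\<close> and with the Hellinger distance.\<close>

lemma xlnx_ge_sqrt:
  fixes y m :: real
  assumes "0 \<le> y" "0 < m"
  shows "y * ln m + 2 * y - 2 * sqrt m * sqrt y \<le> y * ln y"
proof (cases "y = 0")
  case False
  with assms have y: "0 < y" by simp
  define s where "s = sqrt y"
  define r where "r = sqrt m"
  have s: "s > 0" "y = s\<^sup>2" and r: "r > 0" "m = r\<^sup>2" using y assms by (auto simp: s_def r_def)
  have "ln (r / s) \<le> r / s - 1" using s r by (intro ln_le_minus_one) simp
  hence "2 * s\<^sup>2 * (ln r - ln s) \<le> 2 * s\<^sup>2 * (r / s - 1)"
    using s r by (intro mult_left_mono) (simp_all add: ln_div)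
  moreover have "ln y = 2 * ln s" "ln m = 2 * ln r" using s r by (simp_all add: ln_realpow)
  moreover have "sqrt m = r" "sqrt y = s" using s r by simp_all
  ultimately show ?thesis using s by (simp add: algebra_simps power2_eq_square)
qed (use assms in simp)

definition ent2 :: "real \<Rightarrow> real \<Rightarrow> real \<Rightarrow> real" where
  "ent2 p x y = p * (x * ln x) + (1 - p) * (y * ln y)
     - (p * x + (1 - p) * y) * ln (p * x + (1 - p) * y)"

text \<open>With s^2 the mean of the squares and E the mean of a, b, summing
  \<open>xlnx_ge_sqrt\<close> gives entropy at least 2 s^2 - 2 s E. Since (s - E)^2 is nonnegative,
  this is at least the variance s^2 - E^2.\<close>

lemma ent2_lower:
  assumes p: "0 < p" "p < 1" and "0 \<le> a" "0 \<le> b"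
  shows "p * (1 - p) * (a - b)\<^sup>2 \<le> ent2 p (a\<^sup>2) (b\<^sup>2)"
proof (cases "a = 0 \<and> b = 0")
  case True
  thus ?thesis by (simp add: ent2_def)
next
  case False
  define m where "m = p * a\<^sup>2 + (1 - p) * b\<^sup>2"
  have m: "0 < m" using False p unfolding m_def
    by (metis add_nonneg_pos add_pos_nonneg diff_gt_0_iff_gt mult_pos_pos mult_nonneg_nonneg less_imp_le zero_less_power2 zero_le_power2)
  define s where "s = sqrt m"
  have s: "s\<^sup>2 = m" using m by (simp add: s_def)
  have "p * (a\<^sup>2 * ln m + 2 * a\<^sup>2 - 2 * s * a) \<le> p * (a\<^sup>2 * ln (a\<^sup>2))"
    using xlnx_ge_sqrt[of "a\<^sup>2" m] assms m by (intro mult_left_mono) (auto simp: s_def)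
  moreover have "(1 - p) * (b\<^sup>2 * ln m + 2 * b\<^sup>2 - 2 * s * b) \<le> (1 - p) * (b\<^sup>2 * ln (b\<^sup>2))"
    using xlnx_ge_sqrt[of "b\<^sup>2" m] assms m by (intro mult_left_mono) (auto simp: s_def)
  ultimately have "2 * m - 2 * s * (p * a + (1 - p) * b) \<le> ent2 p (a\<^sup>2) (b\<^sup>2)"
    unfolding ent2_def m_def[symmetric] by (simp add: m_def algebra_simps)
  moreover have "0 \<le> (s - (p * a + (1 - p) * b))\<^sup>2" by simp
  moreover have "(s - (p * a + (1 - p) * b))\<^sup>2 = m - 2 * s * (p * a + (1 - p) * b) + (p * a + (1 - p) * b)\<^sup>2"
    using s by (simp add: power2_diff)
  moreover have "m - (p * a + (1 - p) * b)\<^sup>2 = p * (1 - p) * (a - b)\<^sup>2"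
    unfolding m_def by (simp add: algebra_simps power2_eq_square)
  ultimately show ?thesis by linarith
qed

text \<open>Two-point log-Sobolev inequality with a constant of the right order for small p. If a
  and b are comparable, entropy is bounded by a chi-square quantity; if a dominates,
  \<open>a - b\<close> is comparable to a and the logarithm of the density is at most
  \<open>ln (1 / p)\<close>.\<close>

lemma ent2_upper:
  assumes p: "0 < p" "p < 1" and ab: "0 \<le> a" "0 \<le> b"
  shows "ent2 p (a\<^sup>2) (b\<^sup>2) \<le> p * (9 + 4 * ln (1 / p)) * (a - b)\<^sup>2"
proof (cases "a = 0 \<and> b = 0")
  case True
  thus ?thesis by (simp add: ent2_def)
next
  case False
  define m where "m = p * a\<^sup>2 + (1 - p) * b\<^sup>2"
  have m: "0 < m" using False p unfolding m_def
    by (metis add_nonneg_pos add_pos_nonneg diff_gt_0_iff_gt mult_pos_pos mult_nonneg_nonneg less_imp_le zero_less_power2 zero_le_power2)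
  have lnp: "0 \<le> ln (1 / p)" using p by simp
  have e: "ent2 p (a\<^sup>2) (b\<^sup>2) = p * (a\<^sup>2 * (ln (a\<^sup>2) - ln m)) + (1 - p) * (b\<^sup>2 * (ln (b\<^sup>2) - ln m))"
    unfolding ent2_def m_def[symmetric] by (simp add: m_def algebra_simps)
  show ?thesis
  proof (cases "a \<le> 2 * b")
    case True
    hence b: "b > 0" using False ab by auto
    have t: "x * (ln x - ln m) \<le> x * (x / m - 1)" if "x \<ge> 0" for x
    proof (cases "x = 0")
      case f: False
      have "ln (x / m) \<le> x / m - 1" using f that m by (intro ln_le_minus_one) simp
      thus ?thesis using f that m by (intro mult_left_mono) (simp_all add: ln_div)
    qed simp
    have "ent2 p (a\<^sup>2) (b\<^sup>2) \<le> p * (a\<^sup>2 * (a\<^sup>2 / m - 1)) + (1 - p) * (b\<^sup>2 * (b\<^sup>2 / m - 1))"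
      unfolding e using p by (intro add_mono mult_left_mono t) auto
    \<comment> \<open>Variance of the squares divided by their mean. The 9 arises from a + b <= 3b,
      and the denominator from m >= (1 - p) b^2.\<close>
    also have "\<dots> = p * (1 - p) * (a\<^sup>2 - b\<^sup>2)\<^sup>2 / m"
    proof -
      have "p * (a\<^sup>2 * (a\<^sup>2 / m - 1)) + (1 - p) * (b\<^sup>2 * (b\<^sup>2 / m - 1))
        = (p * a^4 + (1 - p) * b^4 - m * m) / m"
      proof -
        have "p * (a\<^sup>2 * (a\<^sup>2 / m - 1)) + (1 - p) * (b\<^sup>2 * (b\<^sup>2 / m - 1))
          = (p * a^4 + (1 - p) * b^4) / m - (p * a\<^sup>2 + (1 - p) * b\<^sup>2)"
          by (simp add: algebra_simps add_divide_distrib diff_divide_distrib power4_eq_xxxx power2_eq_square)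
        thus ?thesis using m unfolding m_def[symmetric] by (simp add: diff_divide_distrib)
      qed
      also have "p * a^4 + (1 - p) * b^4 - m * m = p * (1 - p) * (a\<^sup>2 - b\<^sup>2)\<^sup>2"
        unfolding m_def by (simp add: algebra_simps power2_eq_square power4_eq_xxxx)
      finally show ?thesis .
    qed
    also have "\<dots> \<le> p * (1 - p) * (9 * b\<^sup>2 * (a - b)\<^sup>2) / ((1 - p) * b\<^sup>2)"
    proof (intro frac_le mult_left_mono)
      have "(a\<^sup>2 - b\<^sup>2)\<^sup>2 = (a + b)\<^sup>2 * (a - b)\<^sup>2"
        by (simp add: algebra_simps power2_eq_square)
      also have "\<dots> \<le> (3 * b)\<^sup>2 * (a - b)\<^sup>2"
        using True ab by (intro mult_right_mono power_mono) auto
      finally show "(a\<^sup>2 - b\<^sup>2)\<^sup>2 \<le> 9 * b\<^sup>2 * (a - b)\<^sup>2" by (simp add: power_mult_distrib)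
    qed (use p b in \<open>auto simp: m_def\<close>)
    also have "\<dots> = p * 9 * (a - b)\<^sup>2" using p b by (simp add: field_simps)
    also have "\<dots> \<le> p * (9 + 4 * ln (1 / p)) * (a - b)\<^sup>2"
      using p lnp by (intro mult_right_mono mult_left_mono) auto
    finally show ?thesis .
  next
    \<comment> \<open>Here a < 2(a - b), which gives the 4 in front of the logarithm, and m >= p a^2
      bounds the logarithm by \<open>ln (1 / p)\<close>. The b-term contributes at most p b^2
      because m >= (1 - p) b^2.\<close>
    case c: False
    hence a: "a > 0" using ab by auto
    have d: "a / 2 \<le> a - b" using c by simp
    have "(a / 2)\<^sup>2 \<le> (a - b)\<^sup>2" using d a by (intro power_mono) auto
    hence a4: "a\<^sup>2 \<le> 4 * (a - b)\<^sup>2" by (simp add: power_divide)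
    have b1: "b\<^sup>2 \<le> (a - b)\<^sup>2" using c ab by (intro power_mono) auto
    have "ln (p * a\<^sup>2) \<le> ln m" using p a m by (subst ln_le_cancel_iff) (auto simp: m_def)
    hence 1: "ln (a\<^sup>2) - ln m \<le> ln (1 / p)" using p a by (simp add: ln_mult ln_div)
    have 2: "(1 - p) * (b\<^sup>2 * (ln (b\<^sup>2) - ln m)) \<le> p * b\<^sup>2"
    proof (cases "b = 0")
      case b: False
      have "ln ((1 - p) * b\<^sup>2) \<le> ln m" using p b m by (subst ln_le_cancel_iff) (auto simp: m_def)
      hence "ln (b\<^sup>2) - ln m \<le> ln (1 / (1 - p))" using p b by (simp add: ln_mult ln_div)
      also have "\<dots> \<le> 1 / (1 - p) - 1" using p by (intro ln_le_minus_one) simp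
      also have "\<dots> = p / (1 - p)" using p by (simp add: field_simps)
      finally have "(1 - p) * (b\<^sup>2 * (ln (b\<^sup>2) - ln m)) \<le> (1 - p) * (b\<^sup>2 * (p / (1 - p)))"
        using p by (intro mult_left_mono) auto
      thus ?thesis using p by (simp add: mult.commute)
    qed simp
    have "ent2 p (a\<^sup>2) (b\<^sup>2) \<le> p * (a\<^sup>2 * ln (1 / p)) + p * b\<^sup>2"
      unfolding e using p 1 2 by (intro add_mono mult_left_mono) auto
    also have "\<dots> \<le> p * (4 * (a - b)\<^sup>2 * ln (1 / p)) + p * (9 * (a - b)\<^sup>2)"
    proof -
      have "b\<^sup>2 \<le> 9 * (a - b)\<^sup>2" using b1 zero_le_power2[of "a - b"] by linarith
      thus ?thesis using p a4 lnp by (intro add_mono mult_left_mono mult_right_mono) auto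
    qed
    finally show ?thesis by (simp add: algebra_simps)
  qed
qed

section \<open>Relative entropy on a finite weighted set\<close>

definition entropy_on :: "'a set \<Rightarrow> ('a \<Rightarrow> real) \<Rightarrow> ('a \<Rightarrow> real) \<Rightarrow> real" where
  "entropy_on A w f = (\<Sum>i\<in>A. w i * (f i * ln (f i)))
     - (\<Sum>i\<in>A. w i * f i) * ln (\<Sum>i\<in>A. w i * f i)"

lemma xlnx_jensen:
  fixes w f :: "'a \<Rightarrow> real"
  assumes "finite A" "\<And>i. i \<in> A \<Longrightarrow> 0 \<le> w i" "(\<Sum>i\<in>A. w i) = 1" "\<And>i. i \<in> A \<Longrightarrow> 0 \<le> f i"
  shows "0 \<le> entropy_on A w f"
proof -
  define m where "m = (\<Sum>i\<in>A. w i * f i)"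
  have "0 \<le> m" unfolding m_def using assms by (intro sum_nonneg) auto
  then consider "m = 0" | "m > 0" by linarith
  thus ?thesis
  proof cases
    case 1
    hence "w i * f i = 0" if "i \<in> A" for i
      using assms that unfolding m_def by (subst (asm) sum_nonneg_eq_0_iff) auto
    hence "w i * (f i * ln (f i)) = 0" if "i \<in> A" for i using that by (metis mult.assoc mult_zero_left)
    hence "(\<Sum>i\<in>A. w i * (f i * ln (f i))) = 0" by (intro sum.neutral ballI)
    thus ?thesis using 1 by (simp add: entropy_on_def m_def)
  next
    case 2
    have "m * ln m = (\<Sum>i\<in>A. w i * (f i * ln m + f i - m))"
    proof -
      have "(\<Sum>i\<in>A. w i * m) = m" using assms(3) by (metis mult_1 sum_distrib_right)
      moreover have "m * ln m = (\<Sum>i\<in>A. w i * (f i * ln m))"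
        unfolding mult.assoc[symmetric] sum_distrib_right[symmetric] by (simp add: m_def)
      ultimately show ?thesis
        by (simp add: right_diff_distrib distrib_left sum.distrib sum_subtractf m_def[symmetric])
    qed
    also have "\<dots> \<le> (\<Sum>i\<in>A. w i * (f i * ln (f i)))"
      using 2 assms by (intro sum_mono mult_left_mono xlnx_tangent) auto
    finally show ?thesis by (simp add: entropy_on_def m_def)
  qed
qed

text \<open>Entropy is the minimum over m of the average of the nonnegative gap between x ln x and
  its tangent at m. Using the mean over \<open>A\<close> as m also on \<open>B\<close> can only
  increase the value there, and the terms outside \<open>B\<close> may then be added. This is how
  the empty configuration is discarded, at the cost of \<open>1 / Z\<close>.\<close>

lemma entropy_on_le_restrict:
  fixes w f :: "'a \<Rightarrow> real"
  assumes fin: "finite A" and BA: "B \<subseteq> A" and w: "\<And>i. i \<in> A \<Longrightarrow> 0 \<le> w i"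
    and wA: "(\<Sum>i\<in>A. w i) = 1" and Z: "(\<Sum>i\<in>B. w i) = Z" "0 < Z"
    and f: "\<And>i. i \<in> A \<Longrightarrow> 0 \<le> f i"
  shows "entropy_on B (\<lambda>i. w i / Z) f \<le> entropy_on A w f / Z"
proof -
  define m where "m = (\<Sum>i\<in>A. w i * f i)"
  define M where "M = (\<Sum>i\<in>B. w i / Z * f i)"
  have finB: "finite B" using fin BA finite_subset by blast
  have "0 \<le> m" unfolding m_def using w f by (intro sum_nonneg) auto
  moreover have M0: "0 \<le> M" unfolding M_def using w f Z BA by (intro sum_nonneg) auto
  ultimately consider "m = 0" | "m > 0" by linarith
  thus ?thesis
  proof cases
    case 1
    hence z: "w i * f i = 0" if "i \<in> A" for i
      using w f fin that unfolding m_def by (subst (asm) sum_nonneg_eq_0_iff) auto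
    hence z2: "w i * (f i * g i) = 0" if "i \<in> A" for i g using that by (metis mult.assoc mult_zero_left)
    have "(\<Sum>i\<in>B. w i / Z * (f i * ln (f i))) = 0" using z2 BA
      by (intro sum.neutral) auto
    moreover have "M = 0" unfolding M_def using z BA by (intro sum.neutral) auto
    moreover have "(\<Sum>i\<in>A. w i * (f i * ln (f i))) = 0"
      by (intro sum.neutral ballI z2)
    ultimately show ?thesis using 1 by (simp add: entropy_on_def m_def M_def)
  next
    case 2
    let ?t = "\<lambda>i. f i * ln (f i) - (f i * ln m + f i - m)"
    have t: "0 \<le> ?t i" if "i \<in> A" for i using xlnx_tangent[of "f i" m] f that 2 by simp
    \<comment> \<open>The optimal reference point \<open>M\<close> is replaced by \<open>m\<close>,
      so that the same tangent gaps occur on both sides.\<close>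
    have "entropy_on B (\<lambda>i. w i / Z) f \<le> (\<Sum>i\<in>B. w i / Z * (f i * ln (f i))) - (M * ln m + M - m)"
      using xlnx_tangent[OF M0 2] by (simp add: entropy_on_def M_def)
    also have "M * ln m + M - m = (\<Sum>i\<in>B. w i / Z * (f i * ln m + f i - m))"
    proof -
      have "(\<Sum>i\<in>B. w i / Z) = 1" using Z by (simp flip: sum_divide_distrib)
      hence "(\<Sum>i\<in>B. w i / Z * m) = m" by (metis mult_1 sum_distrib_right)
      thus ?thesis
        unfolding M_def sum_distrib_right
        by (simp add: right_diff_distrib distrib_left sum.distrib sum_subtractf mult.assoc)
    qed
    also have "(\<Sum>i\<in>B. w i / Z * (f i * ln (f i))) - (\<Sum>i\<in>B. w i / Z * (f i * ln m + f i - m))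
       = (\<Sum>i\<in>B. w i * ?t i) / Z"
      unfolding sum_divide_distrib sum_subtractf[symmetric] by (intro sum.cong refl) (simp add: right_diff_distrib diff_divide_distrib)
    also have "\<dots> \<le> (\<Sum>i\<in>A. w i * ?t i) / Z"
      using fin BA w t Z by (intro divide_right_mono sum_mono2) auto
    also have "(\<Sum>i\<in>A. w i * ?t i) = entropy_on A w f"
    proof -
      have "(\<Sum>i\<in>A. w i * m) = m" using wA by (metis mult_1 sum_distrib_right)
      thus ?thesis
        unfolding entropy_on_def m_def[symmetric] unfolding m_def sum_distrib_right
        by (simp add: right_diff_distrib distrib_left sum.distrib sum_subtractf mult.assoc)
    qed
    finally show ?thesis .
  qed
qed

text \<open>A Pinsker inequality with a non-optimal constant: factor h - 1 = (sqrt h - 1)(sqrt h +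
  1) and apply Cauchy-Schwarz. The first factor is a squared Hellinger distance, bounded by the
  entropy; the second is at most 4.\<close>

lemma l1_le_entropy:
  fixes w h :: "'a \<Rightarrow> real"
  assumes fin: "finite A" and w: "\<And>i. i \<in> A \<Longrightarrow> 0 \<le> w i" and wA: "(\<Sum>i\<in>A. w i) = 1"
    and h: "\<And>i. i \<in> A \<Longrightarrow> 0 \<le> h i" and hA: "(\<Sum>i\<in>A. w i * h i) = 1"
  shows "(\<Sum>i\<in>A. w i * \<bar>h i - 1\<bar>)\<^sup>2 \<le> 4 * entropy_on A w h"
proof -
  have "(\<Sum>i\<in>A. w i * \<bar>h i - 1\<bar>) = (\<Sum>i\<in>A. (sqrt (w i) * \<bar>sqrt (h i) - 1\<bar>) * (sqrt (w i) * (sqrt (h i) + 1)))"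
  proof (intro sum.cong refl)
    fix i assume i: "i \<in> A"
    have "h i - 1 = (sqrt (h i) - 1) * (sqrt (h i) + 1)" using h[OF i] by (simp add: algebra_simps)
    hence "\<bar>h i - 1\<bar> = \<bar>sqrt (h i) - 1\<bar> * (sqrt (h i) + 1)" using h[OF i] by (simp add: abs_mult)
    moreover have "w i = sqrt (w i) * sqrt (w i)" using w[OF i] by simp
    ultimately show "w i * \<bar>h i - 1\<bar> = (sqrt (w i) * \<bar>sqrt (h i) - 1\<bar>) * (sqrt (w i) * (sqrt (h i) + 1))"
      by (metis mult.assoc mult.commute)
  qed
  hence "(\<Sum>i\<in>A. w i * \<bar>h i - 1\<bar>)\<^sup>2 \<le> (\<Sum>i\<in>A. (sqrt (w i) * \<bar>sqrt (h i) - 1\<bar>)\<^sup>2) * (\<Sum>i\<in>A. (sqrt (w i) * (sqrt (h i) + 1))\<^sup>2)"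
    by (simp only: Cauchy_Schwarz_ineq_sum)
  also have "\<dots> \<le> entropy_on A w h * 4"
  proof (intro mult_mono)
    have h2: "(\<Sum>i\<in>A. w i * (2 * h i)) = 2"
    proof -
      have "(\<Sum>i\<in>A. w i * (2 * h i)) = 2 * (\<Sum>i\<in>A. w i * h i)"
        unfolding sum_distrib_left by (intro sum.cong refl) simp
      thus ?thesis using hA by simp
    qed
    have "(\<Sum>i\<in>A. (sqrt (w i) * \<bar>sqrt (h i) - 1\<bar>)\<^sup>2) = (\<Sum>i\<in>A. w i * (h i + 1 - 2 * sqrt (h i)))"
      using w h by (intro sum.cong refl) (simp add: power_mult_distrib power2_diff)
    \<comment> \<open>Both \<open>w\<close> and \<open>w * h\<close> have mass 1, so h + 1 may be
      traded for 2h; this matches \<open>xlnx_ge_sqrt\<close> at m = 1.\<close>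
    also have "\<dots> = (\<Sum>i\<in>A. w i * (2 * h i - 2 * sqrt (h i)))"
      unfolding distrib_left right_diff_distrib sum.distrib sum_subtractf using wA hA h2 by simp
    also have "\<dots> \<le> (\<Sum>i\<in>A. w i * (h i * ln (h i)))"
      using w h xlnx_ge_sqrt[of _ 1] by (intro sum_mono mult_left_mono) auto
    finally show "(\<Sum>i\<in>A. (sqrt (w i) * \<bar>sqrt (h i) - 1\<bar>)\<^sup>2) \<le> entropy_on A w h"
      using hA by (simp add: entropy_on_def)
    have "(\<Sum>i\<in>A. (sqrt (w i) * (sqrt (h i) + 1))\<^sup>2) \<le> (\<Sum>i\<in>A. w i * (2 * h i + 2))"
    proof (intro sum_mono)
      fix i assume i: "i \<in> A"
      have "(sqrt (h i) + 1)\<^sup>2 + (sqrt (h i) - 1)\<^sup>2 = 2 * h i + 2"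
        using h[OF i] by (simp add: power2_sum power2_diff)
      hence "(sqrt (h i) + 1)\<^sup>2 \<le> 2 * h i + 2" by (smt (verit) zero_le_power2)
      thus "(sqrt (w i) * (sqrt (h i) + 1))\<^sup>2 \<le> w i * (2 * h i + 2)"
        using w[OF i] by (simp only: power_mult_distrib real_sqrt_pow2) (rule mult_left_mono)
    qed
    also have "\<dots> = 4"
      unfolding distrib_left sum.distrib using wA h2 by (simp flip: sum_distrib_right)
    finally show "(\<Sum>i\<in>A. (sqrt (w i) * (sqrt (h i) + 1))\<^sup>2) \<le> 4" .
  qed (use xlnx_jensen[OF fin w wA h] in \<open>auto intro: sum_nonneg\<close>)
  finally show ?thesis by simp
qed

section \<open>Effective resistance of the torus\<close>

text \<open>Cauchy-Schwarz in the form of resistances in series: \<open>c\<close> plays the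
  resistances, \<open>e\<close> the energies of the pieces.\<close>

lemma sum_square_le_weighted:
  fixes a c e :: "'a \<Rightarrow> real"
  assumes "\<And>i. i \<in> A \<Longrightarrow> 0 \<le> c i" "\<And>i. i \<in> A \<Longrightarrow> 0 \<le> e i" "\<And>i. i \<in> A \<Longrightarrow> (a i)\<^sup>2 \<le> c i * e i"
  shows "(\<Sum>i\<in>A. a i)\<^sup>2 \<le> (\<Sum>i\<in>A. c i) * (\<Sum>i\<in>A. e i)"
proof -
  have "\<bar>\<Sum>i\<in>A. a i\<bar> \<le> (\<Sum>i\<in>A. \<bar>a i\<bar>)" by (rule sum_abs)
  also have "\<dots> \<le> (\<Sum>i\<in>A. sqrt (c i) * sqrt (e i))"
    using assms by (intro sum_mono) (simp add: real_le_rsqrt flip: real_sqrt_mult)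
  finally have "\<bar>\<Sum>i\<in>A. a i\<bar>\<^sup>2 \<le> (\<Sum>i\<in>A. sqrt (c i) * sqrt (e i))\<^sup>2"
    by (intro power_mono) auto
  also have "\<dots> \<le> (\<Sum>i\<in>A. (sqrt (c i))\<^sup>2) * (\<Sum>i\<in>A. (sqrt (e i))\<^sup>2)"
    by (rule Cauchy_Schwarz_ineq_sum)
  also have "\<dots> = (\<Sum>i\<in>A. c i) * (\<Sum>i\<in>A. e i)"
    using assms by (intro arg_cong2[of _ _ _ _ "(*)"] sum.cong) auto
  finally show ?thesis by simp
qed

lemma square_le_if_abs_le: "x\<^sup>2 \<le> y\<^sup>2" if "\<bar>x\<bar> \<le> y" for x y :: real
  using power_mono[of "\<bar>x\<bar>" y 2] that by simp

lemma sum_square_le_card: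
  fixes a :: "'a \<Rightarrow> real"
  shows "(\<Sum>i\<in>A. a i)\<^sup>2 \<le> real (card A) * (\<Sum>i\<in>A. (a i)\<^sup>2)"
  using sum_square_le_weighted[of A "\<lambda>_. 1" "\<lambda>i. (a i)\<^sup>2" a] by simp

lemma sum_inverse_le_ln:
  "(\<Sum>x<Suc m. 1 / real (x + 1)) \<le> 1 + ln (real (Suc m))"
proof (induction m)
  case (Suc m)
  have "ln (real (Suc m) / real (Suc (Suc m))) \<le> real (Suc m) / real (Suc (Suc m)) - 1"
    by (intro ln_le_minus_one) simp
  also have "\<dots> = - 1 / real (Suc (Suc m))" by (simp add: field_simps)
  finally have "1 / real (Suc (Suc m)) \<le> ln (real (Suc (Suc m))) - ln (real (Suc m))"
    by (simp add: ln_div)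
  with Suc show ?case by simp
qed simp

text \<open>Mean over column x of the wedge 0 <= y <= x. Passing from column to column describes a
  unit flow that spreads out from the corner (0, 0), so column x has resistance of order 1/(x +
  1).\<close>

definition wedge_mean :: "(nat \<Rightarrow> nat \<Rightarrow> real) \<Rightarrow> nat \<Rightarrow> real" where
  "wedge_mean G x = (\<Sum>y\<le>x. G x y) / real (x + 1)"

definition wedge_energy :: "(nat \<Rightarrow> nat \<Rightarrow> real) \<Rightarrow> nat \<Rightarrow> real" where
  "wedge_energy G x = (\<Sum>y\<le>x. (G (x + 1) y - G x y)\<^sup>2) + (\<Sum>y\<le>x. (G (x + 1) (y + 1) - G (x + 1) y)\<^sup>2)"

lemma abs_diff_le_variation:
  fixes b :: "nat \<Rightarrow> real"
  assumes "y \<le> k"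
  shows "\<bar>b k - b y\<bar> \<le> (\<Sum>z<k. \<bar>b (z + 1) - b z\<bar>)"
proof -
  have "b k - b y = (\<Sum>z\<in>{y..<k}. b (Suc z) - b z)" using assms by (simp add: sum_Suc_diff')
  hence "\<bar>b k - b y\<bar> \<le> (\<Sum>z\<in>{y..<k}. \<bar>b (z + 1) - b z\<bar>)" by (simp add: sum_abs)
  also have "\<dots> \<le> (\<Sum>z<k. \<bar>b (z + 1) - b z\<bar>)" by (intro sum_mono2) auto
  finally show ?thesis .
qed

text \<open>Two moves: x + 1 parallel horizontal edges shift the mean to the next column, and then
  one more entry is averaged in, which is controlled by the vertical variation. Cauchy-Schwarz over
  x + 1 edges leaves the factor 1/(x + 1).\<close>

lemma wedge_mean_step:
  "(wedge_mean G (Suc x) - wedge_mean G x)\<^sup>2 \<le> (2 / real (x + 1)) * wedge_energy G x"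
proof -
  define b where "b = G (x + 1)"
  define H where "H = (\<Sum>y\<le>x. \<bar>G (x + 1) y - G x y\<bar>)"
  define W where "W = (\<Sum>y\<le>x. \<bar>b (y + 1) - b y\<bar>)"
  define r where "r = real (x + 1)"
  define S where "S = (\<Sum>y\<le>x. b y)"
  have r: "r > 0" by (simp add: r_def)
  have W0: "W \<ge> 0" unfolding W_def by (intro sum_nonneg) auto
  \<comment> \<open>\<open>S / r\<close> is the intermediate quantity: the new column averaged over
    the old height.\<close>
  have 1: "wedge_mean G (Suc x) - S / r = (r * b (x + 1) - S) / (r * (r + 1))"
  proof -
    have "wedge_mean G (Suc x) = (S + b (x + 1)) / (r + 1)"
      by (simp add: wedge_mean_def S_def b_def r_def add.commute)
    hence "wedge_mean G (Suc x) - S / r = (S + b (x + 1)) / (r + 1) - S / r" by simp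
    also have "\<dots> = ((S + b (x + 1)) * r - S * (r + 1)) / ((r + 1) * r)"
      using r by (subst diff_frac_eq) auto
    finally show ?thesis by (simp add: algebra_simps)
  qed
  have "r * b (x + 1) - S = (\<Sum>y\<le>x. b (x + 1) - b y)"
    by (simp add: S_def r_def sum_subtractf)
  also have "\<bar>\<dots>\<bar> \<le> (\<Sum>y\<le>x. \<bar>b (x + 1) - b y\<bar>)" by (rule sum_abs)
  also have "\<dots> \<le> (\<Sum>y\<le>x. W)"
    using abs_diff_le_variation[of _ "x + 1" b]
    by (intro sum_mono) (auto simp: W_def lessThan_Suc_atMost)
  also have "\<dots> = r * W" by (simp add: r_def)
  finally have "\<bar>wedge_mean G (Suc x) - S / r\<bar> \<le> r * W / (r * (r + 1))"
    unfolding 1 abs_divide using r by (simp only: abs_of_pos mult_pos_pos) (intro divide_right_mono, auto)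
  also have "\<dots> \<le> W / r" using r W0 by (simp add: frac_le)
  finally have A: "\<bar>wedge_mean G (Suc x) - S / r\<bar> \<le> W / r" .
  have "S / r - wedge_mean G x = (\<Sum>y\<le>x. G (x + 1) y - G x y) / r"
    by (simp add: wedge_mean_def S_def b_def r_def sum_subtractf diff_divide_distrib)
  hence B: "\<bar>S / r - wedge_mean G x\<bar> \<le> H / r"
    unfolding H_def using r by (simp add: abs_div divide_right_mono)
  have "\<bar>wedge_mean G (Suc x) - wedge_mean G x\<bar> \<le> (H + W) / r"
    using A B by (simp add: add_divide_distrib)
  hence "(wedge_mean G (Suc x) - wedge_mean G x)\<^sup>2 \<le> ((H + W) / r)\<^sup>2"
    by (rule square_le_if_abs_le)
  also have "\<dots> = (H + W)\<^sup>2 / r\<^sup>2" by (simp add: power_divide)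
  also have "\<dots> \<le> (2 * r * wedge_energy G x) / r\<^sup>2"
  proof (intro divide_right_mono)
    have "H\<^sup>2 \<le> r * (\<Sum>y\<le>x. (G (x + 1) y - G x y)\<^sup>2)"
      unfolding H_def r_def using sum_square_le_card[of "\<lambda>y. \<bar>G (x + 1) y - G x y\<bar>" "{..x}"] by simp
    moreover have "W\<^sup>2 \<le> r * (\<Sum>y\<le>x. (b (y + 1) - b y)\<^sup>2)"
      unfolding W_def r_def using sum_square_le_card[of "\<lambda>y. \<bar>b (y + 1) - b y\<bar>" "{..x}"] by simp
    moreover have "(H + W)\<^sup>2 + (H - W)\<^sup>2 = 2 * H\<^sup>2 + 2 * W\<^sup>2" by (simp add: power2_sum power2_diff)
    moreover have "0 \<le> (H - W)\<^sup>2" by simp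
    ultimately show "(H + W)\<^sup>2 \<le> 2 * r * wedge_energy G x"
      unfolding wedge_energy_def b_def distrib_left mult.assoc by linarith
  qed simp
  also have "\<dots> = 2 / r * wedge_energy G x" using r by (simp add: power2_eq_square)
  finally show ?thesis by (simp only: r_def)
qed

text \<open>The steps are resistances in series with harmonic sizes; their sum is the logarithm
  typical of dimension two.\<close>

lemma wedge_mean_dist:
  "(wedge_mean G m - G 0 0)\<^sup>2 \<le> 2 * (1 + ln (real (max 1 m))) * (\<Sum>x<m. wedge_energy G x)"
proof -
  have e0: "0 \<le> wedge_energy G x" for x
    unfolding wedge_energy_def by (intro add_nonneg_nonneg sum_nonneg) auto
  have "wedge_mean G m - G 0 0 = (\<Sum>x<m. wedge_mean G (Suc x) - wedge_mean G x)"
    by (subst sum_lessThan_telescope) (simp add: wedge_mean_def)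
  hence "(wedge_mean G m - G 0 0)\<^sup>2 \<le> (\<Sum>x<m. 2 / real (x + 1)) * (\<Sum>x<m. wedge_energy G x)"
    using e0 wedge_mean_step by (simp only:) (rule sum_square_le_weighted, auto)
  also have "(\<Sum>x<m. 2 / real (x + 1)) \<le> 2 * (1 + ln (real (max 1 m)))"
  proof (cases m)
    case (Suc k)
    have "(\<Sum>x<m. 2 / real (x + 1)) = 2 * (\<Sum>x<Suc k. 1 / real (x + 1))"
      unfolding Suc sum_distrib_left by simp
    thus ?thesis using sum_inverse_le_ln[of k] by (simp add: Suc)
  qed simp
  finally show ?thesis using e0 by (simp add: mult_right_mono sum_nonneg)
qed

section \<open>Unrolling the torus around a vertex and bounding its resistances\<close>

lemma sum_mod_shift:
  fixes F :: "int \<Rightarrow> 'a :: comm_monoid_add"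
  assumes "L > 0"
  shows "(\<Sum>x<L. F ((u + int x) mod int L)) = (\<Sum>i\<in>{0..<int L}. F i)"
proof (rule sum.reindex_bij_betw)
  let ?f = "\<lambda>x. (u + int x) mod int L"
  have inj: "inj_on ?f {..<L}"
  proof (rule inj_onI)
    fix x y assume xy: "x \<in> {..<L}" "y \<in> {..<L}" and "?f x = ?f y"
    hence "[u + int x = u + int y] (mod int L)" by (simp add: cong_def)
    hence "[int x = int y] (mod int L)" by (simp only: cong_add_lcancel)
    thus "x = y" using xy by (simp add: cong_def)
  qed
  moreover have "?f ` {..<L} = {0..<int L}"
    using assms inj by (intro card_subset_eq) (auto simp: card_image)
  ultimately show "bij_betw ?f {..<L} {0..<int L}" by (simp add: bij_betw_def)
qed

lemma sum_torus_shift: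
  fixes F :: "int \<times> int \<Rightarrow> 'a :: comm_monoid_add"
  assumes "L > 0"
  shows "(\<Sum>x<L. \<Sum>y<L. F ((u + int x) mod int L, (v + int y) mod int L)) = (\<Sum>a\<in>torus_verts L. F a)"
proof -
  have "(\<Sum>x<L. \<Sum>y<L. F ((u + int x) mod int L, (v + int y) mod int L))
     = (\<Sum>x<L. \<Sum>j\<in>{0..<int L}. F ((u + int x) mod int L, j))"
    using sum_mod_shift[OF assms, of "\<lambda>j. F ((u + int _) mod int L, j)"] by simp
  also have "\<dots> = (\<Sum>i\<in>{0..<int L}. \<Sum>j\<in>{0..<int L}. F (i, j))"
    using sum_mod_shift[OF assms, of "\<lambda>i. \<Sum>j\<in>{0..<int L}. F (i, j)"] by simp
  finally show ?thesis unfolding torus_verts_def by (simp add: sum.cartesian_product)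
qed

text \<open>Ordered pairs: each edge is counted in both directions. For \<open>L = 2\<close> the
  neighbours at +1 and -1 coincide and are counted once.\<close>

definition torus_energy :: "nat \<Rightarrow> (int \<times> int \<Rightarrow> real) \<Rightarrow> real" where
  "torus_energy L g = (\<Sum>a\<in>torus_verts L. \<Sum>b | b \<in> torus_verts L \<and> torus_adj L a b. (g a - g b)\<^sup>2)"

text \<open>Every vertex sees its forward neighbour in each direction among the ordered pairs, so no
  case distinction for \<open>L = 2\<close> arises. Horizontal and vertical edges are each bounded
  by the full energy, which costs a factor 2 later.\<close>

lemma torus_energy_directed:
  assumes "L > 0"
  shows "(\<Sum>(i, j)\<in>torus_verts L. (g ((i + 1) mod int L, j) - g (i, j))\<^sup>2) \<le> torus_energy L g" (is "?A \<le> _")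
    and "(\<Sum>(i, j)\<in>torus_verts L. (g (i, (j + 1) mod int L) - g (i, j))\<^sup>2) \<le> torus_energy L g" (is "?B \<le> _")
proof -
  have *: "(g b - g a)\<^sup>2 \<le> (\<Sum>b | b \<in> torus_verts L \<and> torus_adj L a b. (g a - g b)\<^sup>2)"
    if "b \<in> torus_verts L" "torus_adj L a b" for a b
    using member_le_sum[of b "{b. b \<in> torus_verts L \<and> torus_adj L a b}" "\<lambda>b. (g a - g b)\<^sup>2"] that
    by (simp add: power2_commute[of "g b"])
  have cg: "[i - (i + 1) mod int L = -1] (mod int L)" for i
    by (simp add: cong_def mod_diff_right_eq)
  show "?A \<le> torus_energy L g" unfolding torus_energy_def
  proof (intro sum_mono, clarify)
    fix i j assume ij: "(i, j) \<in> torus_verts L"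
    have "((i + 1) mod int L, j) \<in> torus_verts L" using ij assms by (auto simp: torus_verts_def)
    moreover have "torus_adj L (i, j) ((i + 1) mod int L, j)"
      using calculation ij cg[of i] unfolding torus_adj_def by auto
    ultimately show "(g ((i + 1) mod int L, j) - g (i, j))\<^sup>2
      \<le> (\<Sum>b | b \<in> torus_verts L \<and> torus_adj L (i, j) b. (g (i, j) - g b)\<^sup>2)" by (rule *)
  qed
  show "?B \<le> torus_energy L g" unfolding torus_energy_def
  proof (intro sum_mono, clarify)
    fix i j assume ij: "(i, j) \<in> torus_verts L"
    have "(i, (j + 1) mod int L) \<in> torus_verts L" using ij assms by (auto simp: torus_verts_def)
    moreover have "torus_adj L (i, j) (i, (j + 1) mod int L)"
      using calculation ij cg[of j] unfolding torus_adj_def by auto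
    ultimately show "(g (i, (j + 1) mod int L) - g (i, j))\<^sup>2
      \<le> (\<Sum>b | b \<in> torus_verts L \<and> torus_adj L (i, j) b. (g (i, j) - g b)\<^sup>2)" by (rule *)
  qed
qed

lemma torus_energy_shift:
  assumes "L > 0" and G: "\<And>x y. G x y = g ((u + int x) mod int L, (v + int y) mod int L)"
  shows "(\<Sum>x<L. \<Sum>y<L. (G (x + 1) y - G x y)\<^sup>2) \<le> torus_energy L g" (is ?A)
    and "(\<Sum>x<L. \<Sum>y<L. (G x (y + 1) - G x y)\<^sup>2) \<le> torus_energy L g" (is ?B)
proof -
  have m: "(u + int (x + 1)) mod int L = ((u + int x) mod int L + 1) mod int L" for u x
    by (simp add: mod_add_left_eq add.assoc add.commute[of 1])
  have "(\<Sum>x<L. \<Sum>y<L. (G (x + 1) y - G x y)\<^sup>2)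
    = (\<Sum>(i, j)\<in>torus_verts L. (g ((i + 1) mod int L, j) - g (i, j))\<^sup>2)"
    unfolding G m by (subst sum_torus_shift[OF assms(1), of _ u v, symmetric]) simp
  thus ?A using torus_energy_directed(1)[OF assms(1), of g] by simp
  have "(\<Sum>x<L. \<Sum>y<L. (G x (y + 1) - G x y)\<^sup>2)
    = (\<Sum>(i, j)\<in>torus_verts L. (g (i, (j + 1) mod int L) - g (i, j))\<^sup>2)"
    unfolding G m by (subst sum_torus_shift[OF assms(1), of _ u v, symmetric]) simp
  thus ?B using torus_energy_directed(2)[OF assms(1), of g] by simp
qed

definition column_mean :: "nat \<Rightarrow> (int \<times> int \<Rightarrow> real) \<Rightarrow> int \<Rightarrow> real" where
  "column_mean L g c = (\<Sum>j\<in>{0..<int L}. g (c mod int L, j)) / real L"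

lemma torus_energy_nonneg: "0 \<le> torus_energy L g"
  unfolding torus_energy_def by (intro sum_nonneg) auto

text \<open>A flow between full columns splits evenly over L parallel rows of length at most L, so
  its resistance is bounded without a logarithm. Formally: Cauchy-Schwarz over L^2 edges against the
  normalisation 1/L^2.\<close>

lemma column_mean_dist:
  assumes L: "L > 0"
  shows "(column_mean L g c - column_mean L g c')\<^sup>2 \<le> torus_energy L g"
proof -
  define G where "G x y = g ((c' + int x) mod int L, (0 + int y) mod int L)" for x y
  define k where "k = nat ((c - c') mod int L)"
  have k: "int k = (c - c') mod int L" "k < L" using L by (auto simp: k_def nat_less_iff)
  have cm: "column_mean L g (c' + int x) = (\<Sum>y<L. G x y) / real L" for x
    unfolding column_mean_def G_def using sum_mod_shift[OF L, of "\<lambda>j. g ((c' + int x) mod int L, j)" 0] by simp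
  have "(c' + int k) mod int L = c mod int L" unfolding k by (simp add: mod_add_right_eq)
  hence "column_mean L g c = column_mean L g (c' + int k)" by (simp add: column_mean_def)
  hence "column_mean L g c - column_mean L g c' = (\<Sum>y<L. G k y - G 0 y) / real L"
    using cm[of k] cm[of 0] by (simp add: sum_subtractf diff_divide_distrib)
  also have "\<bar>\<dots>\<bar> \<le> (\<Sum>y<L. \<bar>G k y - G 0 y\<bar>) / real L"
    by (simp add: abs_div divide_right_mono)
  also have "\<dots> \<le> (\<Sum>y<L. \<Sum>x<L. \<bar>G (x + 1) y - G x y\<bar>) / real L"
  proof (intro divide_right_mono sum_mono)
    fix y
    have "\<bar>G k y - G 0 y\<bar> \<le> (\<Sum>x<k. \<bar>G (x + 1) y - G x y\<bar>)"
      using abs_diff_le_variation[of 0 k "\<lambda>x. G x y"] by simp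
    also have "\<dots> \<le> (\<Sum>x<L. \<bar>G (x + 1) y - G x y\<bar>)" using k by (intro sum_mono2) auto
    finally show "\<bar>G k y - G 0 y\<bar> \<le> (\<Sum>x<L. \<bar>G (x + 1) y - G x y\<bar>)" .
  qed simp
  also have "\<dots> = (\<Sum>z\<in>{..<L} \<times> {..<L}. \<bar>G (fst z + 1) (snd z) - G (fst z) (snd z)\<bar>) / real L" (is "_ = ?S / _")
    by (subst sum.swap) (simp add: sum.cartesian_product case_prod_unfold)
  finally have "(column_mean L g c - column_mean L g c')\<^sup>2 \<le> (?S / real L)\<^sup>2"
    by (rule square_le_if_abs_le)
  also have "\<dots> = ?S\<^sup>2 / (real L * real L)" by (simp add: power_divide power2_eq_square)
  also have "\<dots> \<le> (real L * real L * torus_energy L g) / (real L * real L)"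
  proof (intro divide_right_mono)
    have "?S\<^sup>2 \<le> real L * real L * (\<Sum>z\<in>{..<L} \<times> {..<L}. (G (fst z + 1) (snd z) - G (fst z) (snd z))\<^sup>2)"
      using sum_square_le_card[of "\<lambda>z. \<bar>G (fst z + 1) (snd z) - G (fst z) (snd z)\<bar>" "{..<L} \<times> {..<L}"] by simp
    also have "(\<Sum>z\<in>{..<L} \<times> {..<L}. (G (fst z + 1) (snd z) - G (fst z) (snd z))\<^sup>2)
      = (\<Sum>x<L. \<Sum>y<L. (G (x + 1) y - G x y)\<^sup>2)"
      by (simp add: sum.cartesian_product case_prod_unfold)
    also have "\<dots> \<le> torus_energy L g" by (rule torus_energy_shift(1)[OF L]) (rule G_def)
    finally show "?S\<^sup>2 \<le> real L * real L * torus_energy L g" by (simp add: mult_left_mono)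
  qed simp
  finally show ?thesis using L by simp
qed

text \<open>The wedge issuing from (u, v) widens until its last column covers a whole column of the
  torus. The 4 is the 2 of \<open>wedge_mean_dist\<close> times 2 for the horizontal and the
  vertical energy.\<close>

lemma torus_point_column_dist:
  assumes L: "L > 0" and uv: "(u, v) \<in> torus_verts L"
  shows "(column_mean L g (u + int L - 1) - g (u, v))\<^sup>2 \<le> 4 * (1 + ln (real L)) * torus_energy L g"
proof -
  define G where "G x y = g ((u + int x) mod int L, (v + int y) mod int L)" for x y
  have G00: "G 0 0 = g (u, v)" using uv by (auto simp: G_def torus_verts_def)
  \<comment> \<open>At x = L - 1 the wedge column has exactly L entries and winds round the torus
    once.\<close>
  have "wedge_mean G (L - 1) = column_mean L g (u + int L - 1)"
  proof -
    have "{..L - 1} = {..<L}" using L by auto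
    hence "wedge_mean G (L - 1) = (\<Sum>y<L. G (L - 1) y) / real L"
      using L by (simp add: wedge_mean_def of_nat_diff)
    thus ?thesis unfolding G_def column_mean_def
      using sum_mod_shift[OF L, of "\<lambda>j. g ((u + int (L - 1)) mod int L, j)" v] L
      by (simp add: of_nat_diff algebra_simps)
  qed
  hence "(column_mean L g (u + int L - 1) - g (u, v))\<^sup>2
      \<le> 2 * (1 + ln (real (max 1 (L - 1)))) * (\<Sum>x<L - 1. wedge_energy G x)"
    using wedge_mean_dist[of G "L - 1"] G00 by simp
  also have "\<dots> \<le> 2 * (1 + ln (real L)) * (2 * torus_energy L g)"
  proof (rule mult_mono)
    have "ln (real (max 1 (L - 1))) \<le> ln (real L)" using L by (subst ln_le_cancel_iff) auto
    thus "2 * (1 + ln (real (max 1 (L - 1)))) \<le> 2 * (1 + ln (real L))" by simp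
    have "(\<Sum>x<L - 1. \<Sum>y\<le>x. (G (x + 1) y - G x y)\<^sup>2) \<le> (\<Sum>x<L - 1. \<Sum>y<L. (G (x + 1) y - G x y)\<^sup>2)"
      by (intro sum_mono sum_mono2) auto
    also have "\<dots> \<le> (\<Sum>x<L. \<Sum>y<L. (G (x + 1) y - G x y)\<^sup>2)"
      by (intro sum_mono2 sum_nonneg) auto
    also have "\<dots> \<le> torus_energy L g" by (rule torus_energy_shift(1)[OF L]) (rule G_def)
    finally have 1: "(\<Sum>x<L - 1. \<Sum>y\<le>x. (G (x + 1) y - G x y)\<^sup>2) \<le> torus_energy L g" .
    have "(\<Sum>x<L - 1. \<Sum>y\<le>x. (G (x + 1) (y + 1) - G (x + 1) y)\<^sup>2)
      \<le> (\<Sum>x<L - 1. \<Sum>y<L. (G (x + 1) (y + 1) - G (x + 1) y)\<^sup>2)"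
      by (intro sum_mono sum_mono2) auto
    also have "\<dots> = (\<Sum>x\<in>{1..<L}. \<Sum>y<L. (G x (y + 1) - G x y)\<^sup>2)"
      by (rule sum.reindex_bij_witness[of _ "\<lambda>x. x - 1" "\<lambda>x. x + 1"]) auto
    also have "\<dots> \<le> (\<Sum>x<L. \<Sum>y<L. (G x (y + 1) - G x y)\<^sup>2)"
      by (intro sum_mono2 sum_nonneg) auto
    also have "\<dots> \<le> torus_energy L g" by (rule torus_energy_shift(2)[OF L]) (rule G_def)
    finally show "(\<Sum>x<L - 1. wedge_energy G x) \<le> 2 * torus_energy L g"
      using 1 unfolding wedge_energy_def sum.distrib by simp
    show "0 \<le> (\<Sum>x<L - 1. wedge_energy G x)"
      unfolding wedge_energy_def by (intro sum_nonneg add_nonneg_nonneg) auto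
  qed (use L in auto)
  also have "\<dots> = 4 * (1 + ln (real L)) * torus_energy L g" by simp
  finally show ?thesis .
qed

text \<open>Three legs: point to column, column to column, column to point. The constant is 27 = 3
  (4 + 4 + 1).\<close>

lemma torus_resistance:
  assumes L: "L > 0" and u: "u \<in> torus_verts L" and v: "v \<in> torus_verts L"
  shows "(g u - g v)\<^sup>2 \<le> 27 * (1 + ln (real L)) * torus_energy L g"
proof -
  define a where "a = column_mean L g (fst u + int L - 1) - g u"
  define b where "b = column_mean L g (fst v + int L - 1) - g v"
  define d where "d = column_mean L g (fst v + int L - 1) - column_mean L g (fst u + int L - 1)"
  define T where "T = (1 + ln (real L)) * torus_energy L g"
  have a: "a\<^sup>2 \<le> 4 * T"
    using torus_point_column_dist[OF L, of "fst u" "snd u" g] u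
    unfolding a_def T_def mult.assoc[symmetric] by simp
  have b: "b\<^sup>2 \<le> 4 * T"
    using torus_point_column_dist[OF L, of "fst v" "snd v" g] v
    unfolding b_def T_def mult.assoc[symmetric] by simp
  have "d\<^sup>2 \<le> torus_energy L g" unfolding d_def by (rule column_mean_dist[OF L])
  also have "\<dots> \<le> T" using L torus_energy_nonneg[of L g] unfolding T_def
    by (simp add: mult_le_cancel_right1 algebra_simps)
  finally have d: "d\<^sup>2 \<le> T" .
  have "g u - g v = b - a - d" by (simp add: a_def b_def d_def)
  moreover have "(b - a - d)\<^sup>2 \<le> 3 * (a\<^sup>2 + b\<^sup>2 + d\<^sup>2)"
  proof -
    have "0 \<le> (a + b)\<^sup>2 + (a - d)\<^sup>2 + (b + d)\<^sup>2" by simp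
    thus ?thesis by (simp add: power2_eq_square algebra_simps)
  qed
  ultimately have "(g u - g v)\<^sup>2 \<le> 3 * (a\<^sup>2 + b\<^sup>2 + d\<^sup>2)" by simp
  also have "\<dots> \<le> 3 * (4 * T + 4 * T + T)" using a b d by (intro mult_left_mono add_mono) auto
  also have "\<dots> = 27 * T" by simp
  finally show ?thesis by (simp only: T_def mult.assoc)
qed

section \<open>The process as an average of conditional expectations\<close>

text \<open>Configurations are encoded by their sets of particles. Elements of \<open>S\<close>
  outside \<open>V\<close> are ignored, so the weight off a site can be applied to a set that
  contains the site.\<close>

definition bernoulli_weight :: "'v set \<Rightarrow> real \<Rightarrow> 'v set \<Rightarrow> real" where
  "bernoulli_weight V p S = (\<Prod>v\<in>V. if v \<in> S then p else 1 - p)"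

lemma bernoulli_weight_pos: "0 < p \<Longrightarrow> p < 1 \<Longrightarrow> 0 < bernoulli_weight V p S"
  unfolding bernoulli_weight_def by (intro prod_pos) auto

lemma bernoulli_weight_insert_irrelevant:
  "v \<notin> V \<Longrightarrow> bernoulli_weight V p (insert v S) = bernoulli_weight V p S"
  unfolding bernoulli_weight_def by (intro prod.cong) auto

lemma sum_Pow_insert:
  fixes F :: "'v set \<Rightarrow> 'b :: comm_monoid_add"
  assumes "finite V" "v \<notin> V"
  shows "(\<Sum>S\<in>Pow (insert v V). F S) = (\<Sum>S\<in>Pow V. F S) + (\<Sum>S\<in>Pow V. F (insert v S))"
proof -
  have "inj_on (insert v) (Pow V)" using assms by (auto simp: inj_on_def)
  moreover have "Pow V \<inter> insert v ` Pow V = {}" using assms by auto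
  ultimately show ?thesis
    using assms by (simp add: Pow_insert sum.union_disjoint sum.reindex)
qed

lemma sum_bernoulli_insert:
  assumes "finite V" "v \<notin> V"
  shows "(\<Sum>S\<in>Pow (insert v V). bernoulli_weight (insert v V) p S * F S)
    = p * (\<Sum>S\<in>Pow V. bernoulli_weight V p S * F (insert v S))
      + (1 - p) * (\<Sum>S\<in>Pow V. bernoulli_weight V p S * F S)"
proof -
  have "bernoulli_weight (insert v V) p S = (1 - p) * bernoulli_weight V p S" if "S \<in> Pow V" for S
    using that assms by (auto simp: bernoulli_weight_def)
  moreover have "bernoulli_weight (insert v V) p (insert v S) = p * bernoulli_weight V p S" for S
    using assms bernoulli_weight_insert_irrelevant[of v V p S] by (simp add: bernoulli_weight_def)
  ultimately show ?thesis
    unfolding sum_Pow_insert[OF assms] sum_distrib_left by (simp add: mult.assoc add.commute)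
qed

lemma sum_bernoulli_split:
  assumes "finite V" "v \<in> V"
  shows "(\<Sum>S\<in>Pow V. bernoulli_weight V p S * F S)
    = (\<Sum>S\<in>Pow (V - {v}). bernoulli_weight (V - {v}) p S * ((1 - p) * F S + p * F (insert v S)))"
proof -
  have "insert v (V - {v}) = V" using assms by auto
  thus ?thesis using sum_bernoulli_insert[of "V - {v}" v p F] assms
    unfolding distrib_left sum.distrib sum_distrib_left by (simp add: mult.left_commute add.commute)
qed

lemma sum_bernoulli: "finite V \<Longrightarrow> (\<Sum>S\<in>Pow V. bernoulli_weight V p S) = 1"
proof (induction V rule: finite_induct)
  case (insert v V)
  thus ?case using sum_bernoulli_insert[of V v p "\<lambda>_. 1"] by simp
qed (simp add: bernoulli_weight_def)

text \<open>Reverse triangle inequality in the weighted L2 space. It lets the Dirichlet form of a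
  marginal be bounded by that of the function itself.\<close>

lemma sqrt_sum_square_dist:
  fixes w a b :: "'a \<Rightarrow> real"
  assumes "finite A" "\<And>i. i \<in> A \<Longrightarrow> 0 \<le> w i"
  shows "(sqrt (\<Sum>i\<in>A. w i * (a i)\<^sup>2) - sqrt (\<Sum>i\<in>A. w i * (b i)\<^sup>2))\<^sup>2 \<le> (\<Sum>i\<in>A. w i * (a i - b i)\<^sup>2)"
proof -
  define X where "X = (\<Sum>i\<in>A. w i * (a i)\<^sup>2)"
  define Y where "Y = (\<Sum>i\<in>A. w i * (b i)\<^sup>2)"
  have X: "X \<ge> 0" and Y: "Y \<ge> 0" unfolding X_def Y_def using assms by (auto intro!: sum_nonneg)

  have "(\<Sum>i\<in>A. (sqrt (w i) * a i) * (sqrt (w i) * b i))\<^sup>2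
      \<le> (\<Sum>i\<in>A. (sqrt (w i) * a i)\<^sup>2) * (\<Sum>i\<in>A. (sqrt (w i) * b i)\<^sup>2)"
    by (rule Cauchy_Schwarz_ineq_sum)
  also have "(\<Sum>i\<in>A. (sqrt (w i) * a i)\<^sup>2) = X"
    unfolding X_def using assms by (intro sum.cong) (auto simp: power_mult_distrib)
  also have "(\<Sum>i\<in>A. (sqrt (w i) * b i)\<^sup>2) = Y"
    unfolding Y_def using assms by (intro sum.cong) (auto simp: power_mult_distrib)
  also have "(\<Sum>i\<in>A. (sqrt (w i) * a i) * (sqrt (w i) * b i)) = (\<Sum>i\<in>A. w i * (a i * b i))"
  proof (intro sum.cong refl)
    fix i assume "i \<in> A"
    hence "sqrt (w i) * sqrt (w i) = w i" using assms by simp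
    thus "(sqrt (w i) * a i) * (sqrt (w i) * b i) = w i * (a i * b i)"
      by (simp add: mult.assoc mult.left_commute[of "a i"])
  qed
  finally have "\<bar>\<Sum>i\<in>A. w i * (a i * b i)\<bar> \<le> sqrt (X * Y)" by (simp add: real_le_rsqrt)
  hence *: "(\<Sum>i\<in>A. w i * (a i * b i)) \<le> sqrt X * sqrt Y" by (simp add: real_sqrt_mult)
  have "(\<Sum>i\<in>A. w i * (a i - b i)\<^sup>2) = (\<Sum>i\<in>A. w i * (a i)\<^sup>2 + w i * (b i)\<^sup>2 - 2 * (w i * (a i * b i)))"
    by (intro sum.cong refl) (simp add: power2_diff algebra_simps)
  also have "\<dots> = X + Y - 2 * (\<Sum>i\<in>A. w i * (a i * b i))"
    by (simp add: X_def Y_def sum.distrib sum_subtractf sum_distrib_left)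
  finally have "(\<Sum>i\<in>A. w i * (a i - b i)\<^sup>2) = X + Y - 2 * (\<Sum>i\<in>A. w i * (a i * b i))" .
  moreover have "(sqrt X - sqrt Y)\<^sup>2 = X + Y - 2 * (sqrt X * sqrt Y)"
    using X Y by (simp add: power2_diff)
  ultimately show ?thesis using * unfolding X_def[symmetric] Y_def[symmetric] by simp
qed

text \<open>Tensorisation by induction on the sites: entropy is the average of the two fibre
  entropies plus the two-point entropy of the fibre means. The latter falls to
  \<open>ent2_upper\<close> applied to the square roots of the means, followed by
  \<open>sqrt_sum_square_dist\<close>.\<close>

lemma bernoulli_log_sobolev:
  fixes g :: "'v set \<Rightarrow> real"
  assumes p: "0 < p" "p < 1" and "finite V"
  shows "entropy_on (Pow V) (bernoulli_weight V p) (\<lambda>S. (g S)\<^sup>2)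
    \<le> p * (9 + 4 * ln (1 / p)) *
      (\<Sum>v\<in>V. \<Sum>S\<in>Pow (V - {v}). bernoulli_weight (V - {v}) p S * (g (insert v S) - g S)\<^sup>2)"
  using \<open>finite V\<close>
proof (induction V arbitrary: g rule: finite_induct)
  case empty
  show ?case by (simp add: entropy_on_def bernoulli_weight_def)
next
  case (insert v V)
  let ?w = "bernoulli_weight V p"
  let ?K = "p * (9 + 4 * ln (1 / p))"
  let ?D = "\<lambda>V g. \<Sum>u\<in>V. \<Sum>S\<in>Pow (V - {u}). bernoulli_weight (V - {u}) p S * (g (insert u S) - g S :: real)\<^sup>2"
  define g1 where "g1 S = g (insert v S)" for S
  define M1 where "M1 = (\<Sum>S\<in>Pow V. ?w S * (g1 S)\<^sup>2)"
  define M0 where "M0 = (\<Sum>S\<in>Pow V. ?w S * (g S)\<^sup>2)"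
  have w: "0 \<le> ?w S" for S using bernoulli_weight_pos[OF p] less_imp_le by blast
  have M: "M1 \<ge> 0" "M0 \<ge> 0" unfolding M1_def M0_def using w by (auto intro!: sum_nonneg)
  have K: "0 \<le> ?K" using p by simp
  have "entropy_on (Pow (insert v V)) (bernoulli_weight (insert v V) p) (\<lambda>S. (g S)\<^sup>2)
    = p * entropy_on (Pow V) ?w (\<lambda>S. (g1 S)\<^sup>2) + (1 - p) * entropy_on (Pow V) ?w (\<lambda>S. (g S)\<^sup>2)
      + ent2 p M1 M0"
    unfolding entropy_on_def sum_bernoulli_insert[OF insert.hyps(1,2)] ent2_def
      g1_def[symmetric] M1_def[symmetric] M0_def[symmetric]
    by (simp add: right_diff_distrib)
  also have "\<dots> \<le> p * (?K * ?D V g1) + (1 - p) * (?K * ?D V g)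
      + ?K * (\<Sum>S\<in>Pow V. ?w S * (g1 S - g S)\<^sup>2)"
  proof (intro add_mono mult_left_mono insert.IH)
    have "ent2 p M1 M0 \<le> ?K * (sqrt M1 - sqrt M0)\<^sup>2"
      using ent2_upper[OF p, of "sqrt M1" "sqrt M0"] M by simp
    also have "\<dots> \<le> ?K * (\<Sum>S\<in>Pow V. ?w S * (g1 S - g S)\<^sup>2)"
      unfolding M1_def M0_def using insert.hyps w K by (intro mult_left_mono sqrt_sum_square_dist) auto
    finally show "ent2 p M1 M0 \<le> ?K * (\<Sum>S\<in>Pow V. ?w S * (g1 S - g S)\<^sup>2)" .
  qed (use p in auto)
  also have "\<dots> = ?K * (p * ?D V g1 + (1 - p) * ?D V g + (\<Sum>S\<in>Pow V. ?w S * (g1 S - g S)\<^sup>2))"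
    by (simp add: distrib_left mult.left_commute)
  also have "p * ?D V g1 + (1 - p) * ?D V g + (\<Sum>S\<in>Pow V. ?w S * (g1 S - g S)\<^sup>2) = ?D (insert v V) g"
  proof -
    have "(\<Sum>S\<in>Pow (insert v V - {u}). bernoulli_weight (insert v V - {u}) p S * (g (insert u S) - g S)\<^sup>2)
      = p * (\<Sum>S\<in>Pow (V - {u}). bernoulli_weight (V - {u}) p S * (g1 (insert u S) - g1 S)\<^sup>2)
       + (1 - p) * (\<Sum>S\<in>Pow (V - {u}). bernoulli_weight (V - {u}) p S * (g (insert u S) - g S)\<^sup>2)"
      if "u \<in> V" for u
    proof -
      have "insert v V - {u} = insert v (V - {u})" using that insert.hyps by auto
      thus ?thesis
        using sum_bernoulli_insert[of "V - {u}" v p "\<lambda>S. (g (insert u S) - g S)\<^sup>2"] insert.hyps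
        by (simp add: g1_def insert_commute)
    qed
    moreover have "insert v V - {v} = V" using insert.hyps by auto
    ultimately show ?thesis using insert.hyps
      by (simp add: sum.distrib sum_distrib_left g1_def)
  qed
  finally show ?case .
qed

lemma sum_square_le_sum_of_squares: "(x + y)\<^sup>2 \<le> 2 * x\<^sup>2 + 2 * y\<^sup>2" for x y :: real
proof -
  have "0 \<le> (x - y)\<^sup>2" by simp
  thus ?thesis by (simp add: power2_sum power2_diff)
qed

section \<open>Resampling operators, reversibility and Dirichlet form\<close>

locale kcip_graph =
  fixes V :: "'v set" and adj :: "'v \<Rightarrow> 'v \<Rightarrow> bool" and p :: real
  assumes finV: "finite V" and V_ne: "V \<noteq> {}"
    and adj_sym: "adj u v \<Longrightarrow> adj v u" and adj_irrefl: "\<not> adj v v"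
    and p_pos: "0 < p" and p_less: "p < 1"
begin

abbreviation "wt \<equiv> bernoulli_weight V p"
abbreviation "wt_off v \<equiv> bernoulli_weight (V - {v}) p"

definition Om :: "'v set set" where "Om = Pow V - {{}}"
definition Z :: real where "Z = 1 - (1 - p) ^ card V"
definition pw :: "'v set \<Rightarrow> real" where "pw S = wt S / Z"
definition mean :: "('v set \<Rightarrow> real) \<Rightarrow> real" where "mean f = (\<Sum>S\<in>Om. pw S * f S)"
definition con :: "'v \<Rightarrow> 'v set \<Rightarrow> bool" where "con v S \<longleftrightarrow> (\<exists>u\<in>S. adj u v)"
definition upd :: "'v \<Rightarrow> ('v set \<Rightarrow> real) \<Rightarrow> 'v set \<Rightarrow> real" where
  "upd v f S = (if con v S then p * f (insert v S) + (1 - p) * f (S - {v}) else f S)"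
definition step :: "('v set \<Rightarrow> real) \<Rightarrow> 'v set \<Rightarrow> real" where
  "step f S = (\<Sum>v\<in>V. upd v f S) / card V"
text \<open>The sum over all sites of the mean conditional variance under a legal resampling. It is
  not divided by \<open>card V\<close>, so one step of the chain sees
  \<open>dir f / card V\<close>.\<close>

definition dir :: "('v set \<Rightarrow> real) \<Rightarrow> real" where
  "dir f = (\<Sum>v\<in>V. \<Sum>S\<in>Pow (V - {v}).
     if con v S then wt_off v S * (p * (1 - p) * (f (insert v S) - f S)\<^sup>2) else 0) / Z"

lemma card_pos: "card V > 0" using finV V_ne by (simp add: card_gt_0_iff)

lemma Z_pos: "0 < Z"
  using power_less_one_iff[of "1 - p" "card V"] card_pos p_pos p_less by (simp add: Z_def)

lemma wt_pos: "0 < wt S" "0 < wt_off v S"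
  using bernoulli_weight_pos p_pos p_less by blast+

lemma pw_pos: "0 < pw S" unfolding pw_def using wt_pos Z_pos by simp

lemma finOm: "finite Om" using finV by (simp add: Om_def)

lemma wt_empty: "wt {} = (1 - p) ^ card V" by (simp add: bernoulli_weight_def)

lemma sum_wt_Om: "(\<Sum>S\<in>Om. wt S) = Z"
proof -
  have "(\<Sum>S\<in>Pow V. wt S) = (\<Sum>S\<in>Om. wt S) + wt {}"
    unfolding Om_def using finV by (subst sum.remove[of _ "{}"]) auto
  thus ?thesis using sum_bernoulli[OF finV, of p] by (simp add: Z_def wt_empty)
qed

lemma sum_pw: "(\<Sum>S\<in>Om. pw S) = 1"
  using sum_wt_Om Z_pos by (simp add: pw_def flip: sum_divide_distrib)

lemma mean_const [simp]: "mean (\<lambda>_. c) = c"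
  using sum_pw by (simp add: mean_def flip: sum_distrib_right)

lemma mean_add: "mean (\<lambda>S. f S + g S) = mean f + mean g"
  by (simp add: mean_def distrib_left sum.distrib)

lemma mean_diff: "mean (\<lambda>S. f S - g S) = mean f - mean g"
  by (simp add: mean_def right_diff_distrib sum_subtractf)

lemma mean_cmult: "mean (\<lambda>S. c * f S) = c * mean f"
  by (simp add: mean_def sum_distrib_left mult.left_commute)

lemma mean_divide: "mean (\<lambda>S. f S / c) = mean f / c"
  by (simp add: mean_def sum_divide_distrib)

lemma mean_sum: "mean (\<lambda>S. \<Sum>i\<in>A. f i S) = (\<Sum>i\<in>A. mean (f i))"
  unfolding mean_def by (simp add: sum_distrib_left sum.swap[of _ A])

lemma mean_mono: "(\<And>S. S \<in> Om \<Longrightarrow> f S \<le> g S) \<Longrightarrow> mean f \<le> mean g"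
  unfolding mean_def using pw_pos by (intro sum_mono mult_left_mono) (auto simp: less_imp_le)

lemma mean_nonneg: "(\<And>S. S \<in> Om \<Longrightarrow> 0 \<le> f S) \<Longrightarrow> 0 \<le> mean f"
  using mean_mono[of "\<lambda>_. 0" f] by simp

lemma con_insert: "con v (insert v S) = con v S" using adj_irrefl by (auto simp: con_def)

lemma con_remove: "con v (S - {v}) = con v S" using adj_irrefl by (auto simp: con_def)

text \<open>A configuration where v may be updated has a particle, so on such configurations the
  conditioning on being nonempty is invisible and the product structure at v is available.\<close>

lemma mean_con:
  assumes v: "v \<in> V"
  shows "mean (\<lambda>S. if con v S then F S else 0) =
    (\<Sum>S\<in>Pow (V - {v}). if con v S then wt_off v S * ((1 - p) * F S + p * F (insert v S)) else 0) / Z"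
proof -
  let ?F = "\<lambda>S. if con v S then F S else 0"
  have "mean ?F = (\<Sum>S\<in>Om. wt S * ?F S) / Z"
    by (simp add: mean_def pw_def sum_divide_distrib)
  also have "(\<Sum>S\<in>Om. wt S * ?F S) = (\<Sum>S\<in>Pow V. wt S * ?F S)"
    using finV by (intro sum.mono_neutral_left) (auto simp: Om_def con_def)
  also have "\<dots> = (\<Sum>S\<in>Pow (V - {v}). wt_off v S * ((1 - p) * ?F S + p * ?F (insert v S)))"
    by (rule sum_bernoulli_split[OF finV v])
  also have "\<dots> = (\<Sum>S\<in>Pow (V - {v}). if con v S then wt_off v S * ((1 - p) * F S + p * F (insert v S)) else 0)"
    by (intro sum.cong) (auto simp: con_insert)
  finally show ?thesis .
qed

lemma upd_off:
  assumes "S \<subseteq> V - {v}" "con v S"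
  shows "upd v f S = p * f (insert v S) + (1 - p) * f S"
    and "upd v f (insert v S) = p * f (insert v S) + (1 - p) * f S"
proof -
  have "S - {v} = S" using assms by auto
  thus "upd v f S = p * f (insert v S) + (1 - p) * f S"
    and "upd v f (insert v S) = p * f (insert v S) + (1 - p) * f S"
    using assms by (auto simp: upd_def con_insert)
qed

text \<open>The constraint at v does not depend on the state of v, so \<open>upd v\<close> is a
  conditional expectation under the stationary law; this is reversibility.\<close>

lemma upd_adjoint:
  assumes v: "v \<in> V"
  shows "mean (\<lambda>S. upd v f S * g S) = mean (\<lambda>S. f S * upd v g S)"
proof -
  have "mean (\<lambda>S. upd v f S * g S) - mean (\<lambda>S. f S * upd v g S)
    = mean (\<lambda>S. if con v S then upd v f S * g S - f S * upd v g S else 0)"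
    unfolding mean_diff[symmetric] by (intro arg_cong[of _ _ mean] ext) (auto simp: upd_def)
  also have "\<dots> = 0"
    unfolding mean_con[OF v] by (intro divide_eq_0_iff[THEN iffD2] disjI1 sum.neutral ballI)
      (auto simp: upd_off algebra_simps)
  finally show ?thesis by simp
qed

text \<open>The summand is the Jensen gap of \<open>\<phi>\<close> at v. The square turns it into a
  variance, x ln x into a two-point entropy.\<close>

lemma mean_comp_upd:
  fixes \<phi> :: "real \<Rightarrow> real"
  assumes v: "v \<in> V"
  shows "mean (\<lambda>S. \<phi> (f S)) - mean (\<lambda>S. \<phi> (upd v f S)) =
    (\<Sum>S\<in>Pow (V - {v}). if con v S then wt_off v S * (p * \<phi> (f (insert v S)) + (1 - p) * \<phi> (f S)
       - \<phi> (p * f (insert v S) + (1 - p) * f S)) else 0) / Z"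
proof -
  have "mean (\<lambda>S. \<phi> (f S)) - mean (\<lambda>S. \<phi> (upd v f S))
    = mean (\<lambda>S. if con v S then \<phi> (f S) - \<phi> (upd v f S) else 0)"
    unfolding mean_diff[symmetric] by (intro arg_cong[of _ _ mean] ext) (auto simp: upd_def)
  also have "\<dots> = (\<Sum>S\<in>Pow (V - {v}). if con v S then wt_off v S * (p * \<phi> (f (insert v S)) + (1 - p) * \<phi> (f S)
       - \<phi> (p * f (insert v S) + (1 - p) * f S)) else 0) / Z"
    unfolding mean_con[OF v]
    by (intro arg_cong[of _ _ "\<lambda>x. x / Z"] sum.cong refl if_cong arg_cong2[of _ _ _ _ "(*)"])
       (auto simp: upd_off algebra_simps)
  finally show ?thesis .
qed

lemma upd_idem: "upd v (upd v f) = upd v f"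
  by (rule ext) (simp add: upd_def con_insert con_remove algebra_simps)

lemma upd_const [simp]: "upd v (\<lambda>_. c) S = c"
  by (simp add: upd_def algebra_simps)

lemma upd_nonneg: "(\<And>S. 0 \<le> f S) \<Longrightarrow> 0 \<le> upd v f S"
  unfolding upd_def using p_pos p_less by simp

lemma step_const [simp]: "step (\<lambda>_. c) S = c"
  using card_pos by (simp add: step_def)

lemma step_nonneg: "(\<And>S. 0 \<le> f S) \<Longrightarrow> 0 \<le> step f S"
  unfolding step_def by (intro divide_nonneg_nonneg sum_nonneg upd_nonneg) auto

lemma step_mult_mean: "mean (\<lambda>S. step f S * g S) = (\<Sum>v\<in>V. mean (\<lambda>S. upd v f S * g S)) / card V"
  unfolding mean_sum[symmetric] mean_divide[symmetric] step_def
  by (simp add: sum_distrib_right)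

lemma step_adjoint: "mean (\<lambda>S. step f S * g S) = mean (\<lambda>S. f S * step g S)"
proof -
  have "mean (\<lambda>S. step f S * g S) = (\<Sum>v\<in>V. mean (\<lambda>S. upd v f S * g S)) / card V"
    by (rule step_mult_mean)
  also have "\<dots> = (\<Sum>v\<in>V. mean (\<lambda>S. upd v g S * f S)) / card V"
  proof (intro arg_cong[of _ _ "\<lambda>x. x / card V"] sum.cong refl)
    fix v assume "v \<in> V"
    have "mean (\<lambda>S. upd v f S * g S) = mean (\<lambda>S. f S * upd v g S)" by (rule upd_adjoint) fact
    thus "mean (\<lambda>S. upd v f S * g S) = mean (\<lambda>S. upd v g S * f S)" by (simp only: mult.commute)
  qed
  also have "\<dots> = mean (\<lambda>S. step g S * f S)" by (rule step_mult_mean[symmetric])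
  finally show ?thesis by (simp add: mult.commute)
qed

lemma mean_step: "mean (step f) = mean f"
  using step_adjoint[of f "\<lambda>_. 1"] by simp

lemma upd_square: assumes "v \<in> V" shows "mean (\<lambda>S. upd v f S * f S) = mean (\<lambda>S. (upd v f S)\<^sup>2)"
  using upd_adjoint[OF assms, of "upd v f" f] by (simp add: upd_idem power2_eq_square)

text \<open>An average of orthogonal projections, by \<open>upd_adjoint\<close> and
  \<open>upd_idem\<close>, has no negative spectrum.\<close>

lemma step_psd: "0 \<le> mean (\<lambda>S. f S * step f S)"
proof -
  have "mean (\<lambda>S. step f S * f S) = (\<Sum>v\<in>V. mean (\<lambda>S. (upd v f S)\<^sup>2)) / card V"
    unfolding step_mult_mean using upd_square by simp
  thus ?thesis by (simp add: mult.commute sum_nonneg mean_nonneg)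
qed

lemma mean_square_minus_step:
  "mean (\<lambda>S. (f S)\<^sup>2) - mean (\<lambda>S. f S * step f S) = dir f / card V"
proof -
  have "mean (\<lambda>S. (f S)\<^sup>2) - mean (\<lambda>S. step f S * f S)
    = (\<Sum>v\<in>V. mean (\<lambda>S. (f S)\<^sup>2) - mean (\<lambda>S. (upd v f S)\<^sup>2)) / card V"
    unfolding step_mult_mean using upd_square card_pos
    by (simp add: sum_subtractf diff_divide_distrib)
  also have "(\<Sum>v\<in>V. mean (\<lambda>S. (f S)\<^sup>2) - mean (\<lambda>S. (upd v f S)\<^sup>2)) = dir f"
    unfolding dir_def sum_divide_distrib
  proof (intro sum.cong refl)
    fix v assume v: "v \<in> V"
    have e: "p * x\<^sup>2 + (1 - p) * y\<^sup>2 - (p * x + (1 - p) * y)\<^sup>2 = p * (1 - p) * (x - y)\<^sup>2" for x y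
      by (simp add: power2_eq_square algebra_simps)
    show "mean (\<lambda>S. (f S)\<^sup>2) - mean (\<lambda>S. (upd v f S)\<^sup>2) =
      (\<Sum>S\<in>Pow (V - {v}). (if con v S then wt_off v S * (p * (1 - p) * (f (insert v S) - f S)\<^sup>2) else 0) / Z)"
      unfolding mean_comp_upd[OF v, of "\<lambda>x. x\<^sup>2" f] e sum_divide_distrib by simp
  qed
  finally show ?thesis by (simp add: mult.commute)
qed

text \<open>Convexity of x ln x passes from the average over v to the single \<open>upd v\<close>;
  the entropy lost at v is a two-point entropy, bounded below by \<open>ent2_lower\<close>.\<close>

lemma entropy_step:
  assumes f: "\<And>S. 0 \<le> f S"
  shows "entropy_on Om pw (step f) \<le> entropy_on Om pw f - dir (\<lambda>S. sqrt (f S)) / card V"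
proof -
  let ?\<phi> = "\<lambda>x::real. x * ln x"
  have n: "0 < real (card V)" using card_pos by simp
  have "mean (\<lambda>S. ?\<phi> (step f S)) \<le> mean (\<lambda>S. (\<Sum>v\<in>V. ?\<phi> (upd v f S)) / card V)"
  proof (intro mean_mono)
    fix S
    have "0 \<le> entropy_on V (\<lambda>_. 1 / card V) (\<lambda>v. upd v f S)"
      using n finV upd_nonneg[OF f] by (intro xlnx_jensen) auto
    thus "?\<phi> (step f S) \<le> (\<Sum>v\<in>V. ?\<phi> (upd v f S)) / card V"
      by (simp add: entropy_on_def step_def flip: sum_divide_distrib)
  qed
  also have "\<dots> = (\<Sum>v\<in>V. mean (\<lambda>S. ?\<phi> (upd v f S))) / card V"
    by (simp add: mean_divide mean_sum)
  also have "\<dots> \<le> mean (\<lambda>S. ?\<phi> (f S)) - dir (\<lambda>S. sqrt (f S)) / card V"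
  proof -
    have "dir (\<lambda>S. sqrt (f S)) \<le> (\<Sum>v\<in>V. mean (\<lambda>S. ?\<phi> (f S)) - mean (\<lambda>S. ?\<phi> (upd v f S)))"
      unfolding dir_def sum_divide_distrib[of _ V]
    proof (intro sum_mono)
      fix v assume v: "v \<in> V"
      have e: "p * (1 - p) * (sqrt x - sqrt y)\<^sup>2 \<le>
         p * ?\<phi> x + (1 - p) * ?\<phi> y - ?\<phi> (p * x + (1 - p) * y)" if "0 \<le> x" "0 \<le> y" for x y
        using ent2_lower[OF p_pos p_less, of "sqrt x" "sqrt y"] that by (simp add: ent2_def)
      show "(\<Sum>S\<in>Pow (V - {v}). if con v S then wt_off v S * (p * (1 - p) * (sqrt (f (insert v S)) - sqrt (f S))\<^sup>2) else 0) / Z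
        \<le> mean (\<lambda>S. ?\<phi> (f S)) - mean (\<lambda>S. ?\<phi> (upd v f S))"
        unfolding mean_comp_upd[OF v, of ?\<phi> f]
      proof (intro divide_right_mono sum_mono)
        fix S
        show "(if con v S then wt_off v S * (p * (1 - p) * (sqrt (f (insert v S)) - sqrt (f S))\<^sup>2) else 0)
          \<le> (if con v S then wt_off v S * (p * ?\<phi> (f (insert v S)) + (1 - p) * ?\<phi> (f S)
           - ?\<phi> (p * f (insert v S) + (1 - p) * f S)) else 0)"
          using mult_left_mono[OF e[OF f f], of "wt_off v S" "insert v S" S] wt_pos(2)[of v S] by simp
      qed (use Z_pos in simp)
    qed
    also have "\<dots> = card V * mean (\<lambda>S. ?\<phi> (f S)) - (\<Sum>v\<in>V. mean (\<lambda>S. ?\<phi> (upd v f S)))"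
      by (simp add: sum_subtractf)
    finally show ?thesis using n by (simp add: field_simps)
  qed
  finally show ?thesis
    using mean_step[of f] by (simp add: entropy_on_def mean_def)
qed

end

section \<open>Comparison with the unconstrained dynamics\<close>

lemma sum_weight_swap:
  fixes w :: "'a \<Rightarrow> real"
  shows "(\<Sum>S\<in>A. w S * (c * (\<Sum>a\<in>B. X a S))) = c * (\<Sum>a\<in>B. \<Sum>S\<in>A. w S * X a S)"
  by (subst sum.swap) (simp add: sum_distrib_left mult.left_commute)

context kcip_graph
begin

text \<open>\<open>S\<close> and \<open>insert a S\<close> have the same image, and together they
  weigh 1/p times the image alone. This is the price of the extra particle.\<close>

lemma sum_wt_insert:
  assumes "a \<in> V"
  shows "(\<Sum>S\<in>Pow V. wt S * H (insert a S)) = (\<Sum>S\<in>Pow V. if a \<in> S then wt S * H S else 0) / p"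
proof -
  have "(\<Sum>S\<in>Pow V. wt S * H (insert a S)) = (\<Sum>S\<in>Pow (V - {a}). wt_off a S * H (insert a S))"
    unfolding sum_bernoulli_split[OF finV assms] by (intro sum.cong refl) (simp add: algebra_simps)
  moreover have "(\<Sum>S\<in>Pow V. if a \<in> S then wt S * H S else 0) = p * (\<Sum>S\<in>Pow (V - {a}). wt_off a S * H (insert a S))"
  proof -
    have "(\<Sum>S\<in>Pow V. if a \<in> S then wt S * H S else 0) = (\<Sum>S\<in>Pow V. wt S * (if a \<in> S then H S else 0))"
      by (intro sum.cong) auto
    also have "\<dots> = (\<Sum>S\<in>Pow (V - {a}). p * (wt_off a S * H (insert a S)))"
      unfolding sum_bernoulli_split[OF finV assms] by (intro sum.cong) auto
    finally show ?thesis by (simp add: sum_distrib_left)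
  qed
  ultimately show ?thesis using p_pos by simp
qed

text \<open>\<open>q a b\<close> is the value at the two-particle state through which the mover
  passes from a to b. By symmetry of \<open>q\<close> both half-moves give the same sum, whence 4 =
  2 * 2.\<close>

lemma sum_adj_square_le:
  fixes q :: "'v \<Rightarrow> 'v \<Rightarrow> real"
  assumes f: "\<And>a b. q a b = q b a"
  shows "(\<Sum>a\<in>V. \<Sum>b | b \<in> V \<and> adj a b. (g a - g b)\<^sup>2) \<le> 4 * (\<Sum>a\<in>V. \<Sum>b | b \<in> V \<and> adj a b. (q a b - g a)\<^sup>2)"
proof -
  have "(\<Sum>a\<in>V. \<Sum>b | b \<in> V \<and> adj a b. (g a - g b :: real)\<^sup>2)
    \<le> (\<Sum>a\<in>V. \<Sum>b | b \<in> V \<and> adj a b. 2 * (q a b - g a)\<^sup>2 + 2 * (q a b - g b)\<^sup>2)"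
  proof (intro sum_mono)
    fix a b
    have "(g a - g b)\<^sup>2 = (- (q a b - g a) + (q a b - g b))\<^sup>2" by simp
    also have "\<dots> \<le> 2 * (- (q a b - g a))\<^sup>2 + 2 * (q a b - g b)\<^sup>2" by (rule sum_square_le_sum_of_squares)
    finally show "(g a - g b)\<^sup>2 \<le> 2 * (q a b - g a)\<^sup>2 + 2 * (q a b - g b)\<^sup>2" by (simp only: power2_minus)
  qed
  also have "\<dots> = 2 * (\<Sum>a\<in>V. \<Sum>b | b \<in> V \<and> adj a b. (q a b - g a)\<^sup>2) + 2 * (\<Sum>a\<in>V. \<Sum>b | b \<in> V \<and> adj a b. (q a b - g b)\<^sup>2)"
    by (simp add: sum.distrib sum_distrib_left)
  also have "(\<Sum>a\<in>V. \<Sum>b | b \<in> V \<and> adj a b. (q a b - g b)\<^sup>2) = (\<Sum>a\<in>V. \<Sum>b | b \<in> V \<and> adj a b. (q a b - g a)\<^sup>2)"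
  proof -
    have "(\<Sum>a\<in>V. \<Sum>b | b \<in> V \<and> adj a b. (q a b - g b)\<^sup>2) = (\<Sum>b\<in>V. \<Sum>a | a \<in> V \<and> adj a b. (q a b - g b)\<^sup>2)"
      by (rule sum.swap_restrict) (use finV in auto)
    also have "\<dots> = (\<Sum>b\<in>V. \<Sum>a | a \<in> V \<and> adj b a. (q b a - g b)\<^sup>2)"
      using adj_sym f by (intro sum.cong refl) auto
    finally show ?thesis .
  qed
  finally show ?thesis by simp
qed

text \<open>A flip at \<open>v\<close> in \<open>S\<close> is routed by moving one extra particle from a fixed particle of \<open>S\<close>
  to \<open>v\<close>, the configuration \<open>S\<close> itself staying untouched. A step of the extra particle from
  \<open>a\<close> to \<open>b\<close> consists of the two legal moves between \<open>insert a S\<close>,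
  \<open>insert b (insert a S)\<close> and \<open>insert b S\<close>.\<close>

lemma entropy_le_dir:
  assumes R: "\<And>g u. u \<in> V \<Longrightarrow> (\<Sum>v\<in>V. (g v - g u)\<^sup>2) \<le> R * (\<Sum>a\<in>V. \<Sum>b | b \<in> V \<and> adj a b. (g a - g b)\<^sup>2)"
    and R0: "0 \<le> R"
    and \<Delta>: "\<And>b. b \<in> V \<Longrightarrow> card {a \<in> V. adj a b} \<le> \<Delta>"
    and f: "\<And>S. 0 \<le> f S"
  shows "entropy_on Om pw f \<le> 4 * (9 + 4 * ln (1 / p)) * R * real \<Delta> / ((1 - p) * p) * dir (\<lambda>S. sqrt (f S))"
proof -
  let ?K = "p * (9 + 4 * ln (1 / p))"
  obtain u0 where u0: "u0 \<in> V" using V_ne by blast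
  \<comment> \<open>The empty set borrows the value of \<open>{u0}\<close>, so the illegal flip
    between them costs nothing and the mover can start there.\<close>
  define h where "h S = (if S = {} then sqrt (f {u0}) else sqrt (f S))" for S
  define Q where "Q T b = (h (insert b T) - h T)\<^sup>2" for T b
  have h0: "0 \<le> h S" for S using f by (simp add: h_def)
  have K0: "0 \<le> ?K" using p_pos p_less by simp
  have local: "(\<Sum>v\<in>V. Q S v) \<le> 4 * R * (\<Sum>a\<in>V. \<Sum>b | b \<in> V \<and> adj a b. Q (insert a S) b)"
    if S: "S \<in> Pow V" for S
  proof -
    \<comment> \<open>The starting point of the mover: adding a particle at u leaves
      \<open>h\<close> unchanged. For nonempty S any particle serves, for the empty set
      \<open>u0\<close>.\<close>
    obtain u where u: "u \<in> V" "h (insert u S) = h S"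
    proof (cases "S = {}")
      case True
      show thesis by (rule that[of u0]) (use u0 True in \<open>auto simp: h_def\<close>)
    next
      case False
      then obtain u where "u \<in> S" by blast
      thus thesis using S by (intro that[of u]) (auto simp: insert_absorb)
    qed
    have "(\<Sum>v\<in>V. Q S v) \<le> R * (\<Sum>a\<in>V. \<Sum>b | b \<in> V \<and> adj a b. (h (insert a S) - h (insert b S))\<^sup>2)"
      using R[OF u(1), of "\<lambda>w. h (insert w S)"] unfolding Q_def u(2) .
    also have "\<dots> \<le> R * (4 * (\<Sum>a\<in>V. \<Sum>b | b \<in> V \<and> adj a b. (h (insert b (insert a S)) - h (insert a S))\<^sup>2))"
      using R0 by (intro mult_left_mono sum_adj_square_le) (auto simp: insert_commute)
    finally show ?thesis by (simp add: Q_def mult.assoc mult.left_commute)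
  qed
  have ls: "entropy_on (Pow V) wt (\<lambda>S. (h S)\<^sup>2)
    \<le> ?K * (\<Sum>v\<in>V. \<Sum>S\<in>Pow (V - {v}). wt_off v S * Q S v)"
    unfolding Q_def by (rule bernoulli_log_sobolev[OF p_pos p_less finV])
  \<comment> \<open>\<open>Q S v\<close> vanishes when v is occupied, so averaging over the state of
    v costs just the factor 1 - p.\<close>
  have off: "(\<Sum>v\<in>V. \<Sum>S\<in>Pow (V - {v}). wt_off v S * Q S v) = (\<Sum>S\<in>Pow V. wt S * (\<Sum>v\<in>V. Q S v)) / (1 - p)"
  proof -
    have "(\<Sum>S\<in>Pow V. wt S * Q S v) / (1 - p) = (\<Sum>S\<in>Pow (V - {v}). wt_off v S * Q S v)" if "v \<in> V" for v
      unfolding sum_bernoulli_split[OF finV that] sum_divide_distrib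
      using p_less by (intro sum.cong refl) (simp add: Q_def)
    hence "(\<Sum>v\<in>V. \<Sum>S\<in>Pow (V - {v}). wt_off v S * Q S v) = (\<Sum>v\<in>V. (\<Sum>S\<in>Pow V. wt S * Q S v) / (1 - p))"
      by simp
    also have "\<dots> = (\<Sum>S\<in>Pow V. wt S * (\<Sum>v\<in>V. Q S v)) / (1 - p)"
      unfolding sum_divide_distrib[symmetric] sum_distrib_left by (subst sum.swap) simp
    finally show ?thesis .
  qed
  have "(\<Sum>S\<in>Pow V. wt S * (\<Sum>v\<in>V. Q S v))
    \<le> (\<Sum>S\<in>Pow V. wt S * (4 * R * (\<Sum>a\<in>V. \<Sum>b | b \<in> V \<and> adj a b. Q (insert a S) b)))"
    using local wt_pos(1) by (intro sum_mono mult_left_mono) (auto simp: less_imp_le)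
  also have "\<dots> = 4 * R * (\<Sum>a\<in>V. \<Sum>S\<in>Pow V. wt S * (\<Sum>b | b \<in> V \<and> adj a b. Q (insert a S) b))"
    by (rule sum_weight_swap)
  also have "(\<Sum>a\<in>V. \<Sum>S\<in>Pow V. wt S * (\<Sum>b | b \<in> V \<and> adj a b. Q (insert a S) b))
    = (\<Sum>a\<in>V. \<Sum>S\<in>Pow V. if a \<in> S then wt S * (\<Sum>b | b \<in> V \<and> adj a b. Q S b) else 0) / p"
    unfolding sum_divide_distrib[of _ V]
    using sum_wt_insert[of _ "\<lambda>S. (\<Sum>b | b \<in> V \<and> adj _ b. Q S b)"] by (intro sum.cong refl) simp
  finally have route: "(\<Sum>S\<in>Pow V. wt S * (\<Sum>v\<in>V. Q S v)) \<le> 4 * R *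
    ((\<Sum>a\<in>V. \<Sum>S\<in>Pow V. if a \<in> S then wt S * (\<Sum>b | b \<in> V \<and> adj a b. Q S b) else 0) / p)" .
  \<comment> \<open>Summing over the mover's position a counts the occupied neighbours of b: at most
    \<open>\<Delta>\<close>, and none unless b may legally be updated. Only legal flips
    survive.\<close>
  have "(\<Sum>a\<in>V. \<Sum>S\<in>Pow V. if a \<in> S then wt S * (\<Sum>b | b \<in> V \<and> adj a b. Q S b) else 0)
    = (\<Sum>b\<in>V. \<Sum>S\<in>Pow V. wt S * (real (card {a \<in> S. adj a b}) * Q S b))"
  proof -
    have "(\<Sum>a\<in>V. \<Sum>S\<in>Pow V. if a \<in> S then wt S * (\<Sum>b | b \<in> V \<and> adj a b. Q S b) else 0)
      = (\<Sum>a\<in>V. \<Sum>S\<in>Pow V. \<Sum>b\<in>V. if a \<in> S \<and> adj a b then wt S * Q S b else 0)"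
      using finV
      by (intro sum.cong refl) (auto simp: sum_distrib_left sum.inter_filter if_distrib[of "(*) _"] cong: if_cong)
    also have "\<dots> = (\<Sum>S\<in>Pow V. \<Sum>b\<in>V. \<Sum>a\<in>V. if a \<in> S \<and> adj a b then wt S * Q S b else 0)"
    proof -
      have "(\<Sum>a\<in>V. \<Sum>S\<in>Pow V. \<Sum>b\<in>V. if a \<in> S \<and> adj a b then wt S * Q S b else 0)
        = (\<Sum>S\<in>Pow V. \<Sum>a\<in>V. \<Sum>b\<in>V. if a \<in> S \<and> adj a b then wt S * Q S b else 0)" by (rule sum.swap)
      also have "\<dots> = (\<Sum>S\<in>Pow V. \<Sum>b\<in>V. \<Sum>a\<in>V. if a \<in> S \<and> adj a b then wt S * Q S b else 0)"
        by (rule sum.cong[OF refl], rule sum.swap)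
      finally show ?thesis .
    qed
    also have "\<dots> = (\<Sum>S\<in>Pow V. \<Sum>b\<in>V. wt S * (real (card {a \<in> S. adj a b}) * Q S b))"
    proof (intro sum.cong refl)
      fix S b assume "S \<in> Pow V"
      hence "{a \<in> V. a \<in> S \<and> adj a b} = {a \<in> S. adj a b}" by auto
      thus "(\<Sum>a\<in>V. if a \<in> S \<and> adj a b then wt S * Q S b else 0) = wt S * (real (card {a \<in> S. adj a b}) * Q S b)"
        using finV by (simp add: sum.inter_filter[symmetric])
    qed
    also have "\<dots> = (\<Sum>b\<in>V. \<Sum>S\<in>Pow V. wt S * (real (card {a \<in> S. adj a b}) * Q S b))"
      by (rule sum.swap)
    finally show ?thesis .
  qed
  also have "\<dots> \<le> (\<Sum>b\<in>V. \<Sum>S\<in>Pow V. real \<Delta> * (wt S * (if con b S then Q S b else 0)))"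
  proof (intro sum_mono)
    fix b S assume b: "b \<in> V" and S: "S \<in> Pow V"
    have "real (card {a \<in> S. adj a b}) \<le> real \<Delta>"
    proof -
      have "card {a \<in> S. adj a b} \<le> card {a \<in> V. adj a b}" using S finV by (intro card_mono) auto
      thus ?thesis using \<Delta>[OF b] by simp
    qed
    moreover have "card {a \<in> S. adj a b} = 0" if "\<not> con b S"
    proof -
      have "{a \<in> S. adj a b} = {}" using that by (auto simp: con_def)
      thus ?thesis by (simp only: card.empty)
    qed
    moreover have "0 \<le> Q S b" by (simp add: Q_def)
    ultimately have "real (card {a \<in> S. adj a b}) * Q S b \<le> real \<Delta> * (if con b S then Q S b else 0)"
      by (cases "con b S") (simp_all add: mult_right_mono)
    hence "wt S * (real (card {a \<in> S. adj a b}) * Q S b) \<le> wt S * (real \<Delta> * (if con b S then Q S b else 0))"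
      using wt_pos(1)[of S] by (intro mult_left_mono) auto
    thus "wt S * (real (card {a \<in> S. adj a b}) * Q S b) \<le> real \<Delta> * (wt S * (if con b S then Q S b else 0))"
      by (simp only: mult.left_commute)
  qed
  also have "\<dots> = real \<Delta> * (Z * dir (\<lambda>S. sqrt (f S)) / p)"
  proof -
    have "(\<Sum>S\<in>Pow V. wt S * (if con b S then Q S b else 0)) = (\<Sum>S\<in>Pow (V - {b}).
       if con b S then wt_off b S * (p * (1 - p) * (sqrt (f (insert b S)) - sqrt (f S))\<^sup>2) else 0) / p"
      if b: "b \<in> V" for b
      unfolding sum_bernoulli_split[OF finV b] sum_divide_distrib
    proof (intro sum.cong refl)
      fix S
      have "con b S \<Longrightarrow> S \<noteq> {}" by (auto simp: con_def)
      thus "wt_off b S * ((1 - p) * (if con b S then Q S b else 0) + p * (if con b (insert b S) then Q (insert b S) b else 0))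
        = (if con b S then wt_off b S * (p * (1 - p) * (sqrt (f (insert b S)) - sqrt (f S))\<^sup>2) else 0) / p"
        using p_pos by (auto simp: con_insert Q_def h_def)
    qed
    thus ?thesis unfolding dir_def using Z_pos
      by (simp add: sum_distrib_left[symmetric] sum_divide_distrib[symmetric])
  qed
  finally have "4 * R * ((\<Sum>a\<in>V. \<Sum>S\<in>Pow V. if a \<in> S then wt S * (\<Sum>b | b \<in> V \<and> adj a b. Q S b) else 0) / p)
    \<le> 4 * R * (real \<Delta> * (Z * dir (\<lambda>S. sqrt (f S)) / p) / p)"
    using R0 p_pos by (intro mult_left_mono divide_right_mono) auto
  with route have "(\<Sum>S\<in>Pow V. wt S * (\<Sum>v\<in>V. Q S v)) \<le> 4 * R * (real \<Delta> * (Z * dir (\<lambda>S. sqrt (f S)) / p) / p)"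
    by (rule order_trans)
  hence "?K * ((\<Sum>S\<in>Pow V. wt S * (\<Sum>v\<in>V. Q S v)) / (1 - p))
    \<le> ?K * (4 * R * (real \<Delta> * (Z * dir (\<lambda>S. sqrt (f S)) / p) / p) / (1 - p))"
    using K0 p_less by (intro mult_left_mono divide_right_mono) auto
  with ls[unfolded off] have main: "entropy_on (Pow V) wt (\<lambda>S. (h S)\<^sup>2)
    \<le> ?K * (4 * R * (real \<Delta> * (Z * dir (\<lambda>S. sqrt (f S)) / p) / p) / (1 - p))"
    by (rule order_trans)
  have "entropy_on Om pw f = entropy_on Om (\<lambda>S. wt S / Z) (\<lambda>S. (h S)\<^sup>2)"
  proof -
    have "(h S)\<^sup>2 = f S" if "S \<in> Om" for S using that f by (simp add: Om_def h_def)
    thus ?thesis unfolding entropy_on_def pw_def[symmetric] by simp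
  qed
  also have "\<dots> \<le> entropy_on (Pow V) wt (\<lambda>S. (h S)\<^sup>2) / Z"
    using finV wt_pos(1) sum_bernoulli[OF finV] sum_wt_Om Z_pos
    by (intro entropy_on_le_restrict) (auto simp: Om_def less_imp_le)
  also have "\<dots> \<le> ?K * (4 * R * (real \<Delta> * (Z * dir (\<lambda>S. sqrt (f S)) / p) / p) / (1 - p)) / Z"
    using main Z_pos by (simp add: divide_right_mono)
  also have "\<dots> = 4 * (9 + 4 * ln (1 / p)) * R * real \<Delta> / ((1 - p) * p) * dir (\<lambda>S. sqrt (f S))"
  proof -
    have "p * c * (4 * R * (real \<Delta> * (Z * X / p) / p) / (1 - p)) / Z = 4 * c * R * real \<Delta> / ((1 - p) * p) * X" for c X
      using p_pos p_less Z_pos by (simp add: mult_ac)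
    thus ?thesis .
  qed
  finally show ?thesis .
qed

end

section \<open>Laws, densities and mixing\<close>

context kcip_graph
begin

text \<open>Translation between 0/1 functions and particle sets. \<open>ind\<close> is a restricted
  function because \<open>kcip_configs\<close> contains only extensional ones.\<close>

definition supp :: "('v \<Rightarrow> nat) \<Rightarrow> 'v set" where "supp x = {v \<in> V. x v = 1}"
definition ind :: "'v set \<Rightarrow> 'v \<Rightarrow> nat" where "ind S = (\<lambda>v\<in>V. if v \<in> S then 1 else 0)"

lemma ind_supp: "x \<in> kcip_configs V \<Longrightarrow> ind (supp x) = x"
  by (rule ext) (auto simp: kcip_configs_def ind_def supp_def PiE_iff extensional_def)

lemma supp_ind: "S \<subseteq> V \<Longrightarrow> supp (ind S) = S"
  by (auto simp: ind_def supp_def)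

lemma supp_Om: "x \<in> kcip_configs V \<Longrightarrow> supp x \<in> Om"
  by (auto simp: kcip_configs_def supp_def Om_def PiE_iff)

lemma ind_configs: "S \<in> Om \<Longrightarrow> ind S \<in> kcip_configs V"
  by (auto simp: kcip_configs_def ind_def Om_def)

lemma supp_bij: "bij_betw supp (kcip_configs V) Om"
  by (rule bij_betw_byWitness[where f' = ind])
     (auto simp: ind_supp supp_ind supp_Om ind_configs, auto simp: Om_def supp_ind)

lemma supp_update:
  assumes "v \<in> V"
  shows "supp (kcip_update V adj x v b) =
    (if con v (supp x) then if b then insert v (supp x) else supp x - {v} else supp x)"
  using assms by (auto simp: kcip_update_def supp_def con_def)

lemma expectation_kcip_step:
  "measure_pmf.expectation (kcip_step V adj p x) (\<lambda>y. f (supp y)) = step f (supp x)"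
proof -
  have "measure_pmf.expectation (kcip_step V adj p x) (\<lambda>y. f (supp y))
    = (\<Sum>v\<in>V. pmf (pmf_of_set V) v *\<^sub>R
        measure_pmf.expectation (map_pmf (kcip_update V adj x v) (bernoulli_pmf p)) (\<lambda>y. f (supp y)))"
    unfolding kcip_step_def using finV V_ne by (intro pmf_expectation_bind) auto
  also have "\<dots> = (\<Sum>v\<in>V. upd v f (supp x) / card V)"
    using finV V_ne p_pos p_less
    by (intro sum.cong refl)
       (simp add: supp_update upd_def algebra_simps add_divide_distrib diff_divide_distrib)
  finally show ?thesis by (simp add: step_def sum_divide_distrib)
qed

lemma set_kcip_law: "x \<in> kcip_configs V \<Longrightarrow> set_pmf (kcip_law V adj p x t) \<subseteq> kcip_configs V"
proof (induction t)
  case (Suc t)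
  have "set_pmf (kcip_step V adj p y) \<subseteq> kcip_configs V" if "y \<in> kcip_configs V" for y
    using that by (intro set_pmf_kcip_step finV V_ne adj_irrefl)
  thus ?case using Suc by auto
qed simp

lemma expectation_kcip_law:
  assumes x: "x \<in> kcip_configs V"
  shows "measure_pmf.expectation (kcip_law V adj p x t) (\<lambda>y. f (supp y)) = (step ^^ t) f (supp x)"
proof (induction t arbitrary: f)
  case (Suc t)
  have fin: "finite (set_pmf (kcip_step V adj p y))" for y
    unfolding kcip_step_def using finV V_ne by auto
  have "measure_pmf.expectation (kcip_law V adj p x (Suc t)) (\<lambda>y. f (supp y))
    = (\<Sum>y\<in>kcip_configs V. pmf (kcip_law V adj p x t) y *\<^sub>R step f (supp y))"
    unfolding kcip_law.simps
    by (subst pmf_expectation_bind[OF finite_kcip_configs[OF finV] fin set_kcip_law[OF x]])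
       (simp add: expectation_kcip_step)
  also have "\<dots> = measure_pmf.expectation (kcip_law V adj p x t) (\<lambda>y. step f (supp y))"
    using set_kcip_law[OF x] finite_kcip_configs[OF finV]
    by (subst integral_measure_pmf[of "kcip_configs V"]) auto
  finally show ?case using Suc.IH[of "step f"] by (simp add: funpow_swap1)
qed simp

lemma prob_kcip_law:
  assumes x: "x \<in> kcip_configs V"
  shows "measure_pmf.prob (kcip_law V adj p x t) A = (step ^^ t) (\<lambda>S. indicator A (ind S)) (supp x)"
proof -
  have "measure_pmf.prob (kcip_law V adj p x t) A
    = measure_pmf.expectation (kcip_law V adj p x t) (indicator A)" by simp
  also have "\<dots> = measure_pmf.expectation (kcip_law V adj p x t) (\<lambda>y. indicator A (ind (supp y)))"
    using set_kcip_law[OF x] ind_supp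
    by (intro integral_cong_AE) (auto simp: AE_measure_pmf_iff subset_iff)
  finally show ?thesis using expectation_kcip_law[OF x, of t "\<lambda>S. indicator A (ind S)"] by simp
qed

lemma kcip_density_eq: "y \<in> kcip_configs V \<Longrightarrow> kcip_density V p y = pw (supp y)"
proof -
  assume y: "y \<in> kcip_configs V"
  have "p ^ (\<Sum>v\<in>V. y v) * (1 - p) ^ (card V - (\<Sum>v\<in>V. y v)) = (\<Prod>v\<in>V. if y v = 1 then p else 1 - p)"
    using y by (intro kcip_weight_eq_prod finV) (auto simp: kcip_configs_def)
  also have "\<dots> = wt (supp y)"
    unfolding bernoulli_weight_def by (intro prod.cong) (auto simp: supp_def)
  finally show ?thesis using y by (simp add: kcip_density_def pw_def Z_def)
qed

lemma prob_kcip_stationary: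
  "measure_pmf.prob (kcip_stationary V p) A = mean (\<lambda>S. indicator A (ind S))"
proof -
  note pmf = pmf_kcip_stationary[OF finV V_ne p_pos p_less]
  have "measure_pmf.prob (kcip_stationary V p) A
    = measure_pmf.expectation (kcip_stationary V p) (indicator A)" by simp
  also have "\<dots> = (\<Sum>y\<in>kcip_configs V. pmf (kcip_stationary V p) y *\<^sub>R indicator A y)"
    by (intro integral_measure_pmf finite_kcip_configs finV)
       (auto simp: set_pmf_iff pmf kcip_density_def split: if_splits)
  also have "\<dots> = (\<Sum>y\<in>kcip_configs V. pw (supp y) * indicator A (ind (supp y)))"
    by (intro sum.cong) (auto simp: pmf kcip_density_eq ind_supp)
  also have "\<dots> = mean (\<lambda>S. indicator A (ind S))"
    unfolding mean_def by (rule sum.reindex_bij_betw[OF supp_bij])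
  finally show ?thesis .
qed

section \<open>Iterates of the Markov operator and convergence in entropy\<close>

lemma upd_add: "upd v (\<lambda>S. f S + g S) S = upd v f S + upd v g S"
  by (simp add: upd_def algebra_simps)

lemma upd_cmult: "upd v (\<lambda>S. c * f S) S = c * upd v f S"
  by (simp add: upd_def algebra_simps)

lemma upd_mono: "(\<And>S. f S \<le> g S) \<Longrightarrow> upd v f S \<le> upd v g S"
  unfolding upd_def using p_pos p_less by (auto intro!: add_mono mult_left_mono)

lemma step_add: "step (\<lambda>S. f S + g S) = (\<lambda>S. step f S + step g S)"
  by (rule ext) (simp add: step_def upd_add sum.distrib add_divide_distrib)

lemma step_cmult: "step (\<lambda>S. c * f S) = (\<lambda>S. c * step f S)"
  by (rule ext) (simp add: step_def upd_cmult flip: sum_distrib_left)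

lemma step_mono: "(\<And>S. f S \<le> g S) \<Longrightarrow> step f S \<le> step g S"
  unfolding step_def by (intro divide_right_mono sum_mono upd_mono) auto

lemma iter_add: "(step ^^ t) (\<lambda>S. f S + g S) = (\<lambda>S. (step ^^ t) f S + (step ^^ t) g S)"
  by (induction t) (simp_all add: step_add)

lemma iter_cmult: "(step ^^ t) (\<lambda>S. c * f S) = (\<lambda>S. c * (step ^^ t) f S)"
  by (induction t) (simp_all add: step_cmult)

lemma iter_diff: "(step ^^ t) (\<lambda>S. f S - g S) = (\<lambda>S. (step ^^ t) f S - (step ^^ t) g S)"
  using iter_add[of t f "\<lambda>S. (-1) * g S"] iter_cmult[of t "-1" g] by simp

lemma iter_const: "(step ^^ t) (\<lambda>_. c) = (\<lambda>_. c)"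
proof (induction t)
  case (Suc t)
  have "step (\<lambda>_. c) = (\<lambda>_. c)" by (rule ext) simp
  thus ?case using Suc by simp
qed simp

lemma iter_mono: "(\<And>S. f S \<le> g S) \<Longrightarrow> (step ^^ t) f S \<le> (step ^^ t) g S"
  by (induction t arbitrary: S) (auto intro: step_mono)

lemma iter_nonneg: "(\<And>S. 0 \<le> f S) \<Longrightarrow> 0 \<le> (step ^^ t) f S"
  by (induction t arbitrary: S) (auto intro: step_nonneg)

lemma iter_adjoint: "mean (\<lambda>S. (step ^^ t) f S * g S) = mean (\<lambda>S. f S * (step ^^ t) g S)"
proof (induction t arbitrary: g)
  case (Suc t)
  have "mean (\<lambda>S. (step ^^ Suc t) f S * g S) = mean (\<lambda>S. (step ^^ t) f S * step g S)"
    by (simp add: step_adjoint)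
  also have "\<dots> = mean (\<lambda>S. f S * (step ^^ t) (step g) S)" by (rule Suc.IH)
  finally show ?case by (simp add: funpow_swap1)
qed simp

lemma mean_iter: "mean ((step ^^ t) f) = mean f"
  by (induction t) (simp_all add: mean_step)

text \<open>The density of a point mass with respect to the stationary law.\<close>

definition delta :: "'v set \<Rightarrow> 'v set \<Rightarrow> real" where
  "delta S0 S = (if S = S0 then 1 / pw S0 else 0)"

lemma mean_delta: "S0 \<in> Om \<Longrightarrow> mean (\<lambda>S. delta S0 S * F S) = F S0"
proof -
  assume S0: "S0 \<in> Om"
  have "mean (\<lambda>S. delta S0 S * F S) = (\<Sum>S\<in>Om. if S = S0 then F S0 else 0)"
    unfolding mean_def using pw_pos[of S0] by (intro sum.cong) (auto simp: delta_def)
  thus ?thesis using S0 finOm by simp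
qed

text \<open>By reversibility \<open>(step ^^ t) (delta S0)\<close> is the density of the law at time
  t started from \<open>S0\<close>.\<close>

lemma iter_eq_mean: "S0 \<in> Om \<Longrightarrow> (step ^^ t) F S0 = mean (\<lambda>S. (step ^^ t) (delta S0) S * F S)"
  by (simp add: iter_adjoint mean_delta)

lemma entropy_iter:
  assumes C: "\<And>f. (\<And>S. 0 \<le> f S) \<Longrightarrow> entropy_on Om pw f \<le> M * (dir (\<lambda>S. sqrt (f S)) / card V)"
    and M: "1 \<le> M" and f: "\<And>S. 0 \<le> f S"
  shows "entropy_on Om pw ((step ^^ t) f) \<le> (1 - 1 / M) ^ t * entropy_on Om pw f"
proof (induction t)
  case (Suc t)
  let ?g = "(step ^^ t) f"
  have g: "0 \<le> ?g S" for S using f by (rule iter_nonneg)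
  have "entropy_on Om pw ?g / M \<le> dir (\<lambda>S. sqrt (?g S)) / card V"
    using C[of ?g] g M by (simp add: field_simps)
  hence "entropy_on Om pw (step ?g) \<le> (1 - 1 / M) * entropy_on Om pw ?g"
    using entropy_step[of ?g] g by (simp add: algebra_simps)
  also have "\<dots> \<le> (1 - 1 / M) * ((1 - 1 / M) ^ t * entropy_on Om pw f)"
    using Suc.IH M by (intro mult_left_mono) auto
  finally show ?case by simp
qed simp

lemma tv_le_l1:
  assumes x: "x \<in> kcip_configs V"
  shows "tv_dist (kcip_law V adj p x t) (kcip_stationary V p)
    \<le> mean (\<lambda>S. \<bar>(step ^^ t) (delta (supp x)) S - 1\<bar>)"
  unfolding tv_dist_def
proof (rule cSUP_least)
  fix A :: "('v \<Rightarrow> nat) set"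
  let ?h = "(step ^^ t) (delta (supp x))"
  let ?F = "\<lambda>S. indicator A (ind S) :: real"
  have "measure_pmf.prob (kcip_law V adj p x t) A - measure_pmf.prob (kcip_stationary V p) A
    = mean (\<lambda>S. ?h S * ?F S) - mean ?F"
    unfolding prob_kcip_law[OF x] prob_kcip_stationary iter_eq_mean[OF supp_Om[OF x]] ..
  also have "\<dots> = mean (\<lambda>S. ?h S * ?F S - ?F S)" by (rule mean_diff[symmetric])
  also have "\<dots> \<le> mean (\<lambda>S. \<bar>?h S - 1\<bar>)"
    by (intro mean_mono) (auto simp: indicator_def)
  finally show "measure_pmf.prob (kcip_law V adj p x t) A - measure_pmf.prob (kcip_stationary V p) A
    \<le> mean (\<lambda>S. \<bar>?h S - 1\<bar>)" .
qed simp

lemma configs_ne: "kcip_configs V \<noteq> {}"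
proof -
  have "V \<in> Om" using V_ne by (simp add: Om_def)
  thus ?thesis using ind_configs by blast
qed

text \<open>A point mass has entropy exactly \<open>ln (1 / pw S)\<close>. The choice of t reduces
  it to 1/100, and \<open>l1_le_entropy\<close> then gives an L1 distance of at most sqrt (4 / 100)
  = 1/5, below 1/4.\<close>

lemma mixed_if_entropy:
  assumes C: "\<And>f. (\<And>S. 0 \<le> f S) \<Longrightarrow> entropy_on Om pw f \<le> M * (dir (\<lambda>S. sqrt (f S)) / card V)"
    and M: "1 \<le> M" and B: "\<And>S. S \<in> Om \<Longrightarrow> ln (1 / pw S) \<le> B" "0 < B"
    and t: "M * ln (100 * B) \<le> real t"
  shows "(SUP x \<in> kcip_configs V. tv_dist (kcip_law V adj p x t) (kcip_stationary V p)) < 1 / 4"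
proof -
  have "tv_dist (kcip_law V adj p x t) (kcip_stationary V p) \<le> 1 / 5" if x: "x \<in> kcip_configs V" for x
  proof -
    let ?S0 = "supp x"
    let ?h = "(step ^^ t) (delta ?S0)"
    have S0: "?S0 \<in> Om" using x by (rule supp_Om)
    have d: "0 \<le> delta ?S0 S" for S using pw_pos[of ?S0] by (simp add: delta_def)
    have "mean (delta ?S0) = 1" using mean_delta[OF S0, of "\<lambda>_. 1"] by simp
    hence m1: "mean ?h = 1" by (simp add: mean_iter)
    have "entropy_on Om pw (delta ?S0) = ln (1 / pw ?S0)"
      using \<open>mean (delta ?S0) = 1\<close> mean_delta[OF S0, of "\<lambda>S. ln (delta ?S0 S)"]
      by (simp add: entropy_on_def mean_def) (simp add: delta_def)
    hence "entropy_on Om pw ?h \<le> (1 - 1 / M) ^ t * ln (1 / pw ?S0)"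
      using entropy_iter[where f = "delta ?S0" and t = t, OF C M d] by simp
    also have "\<dots> \<le> (1 - 1 / M) ^ t * B" using B(1)[OF S0] M by (intro mult_left_mono) auto
    also have "\<dots> \<le> exp (- (1 / M)) ^ t * B"
      using M B exp_ge_add_one_self[of "- (1 / M)"] by (intro mult_right_mono power_mono) auto
    also have "\<dots> = exp (- (t / M)) * B" by (simp flip: exp_of_nat_mult)
    also have "\<dots> \<le> exp (- ln (100 * B)) * B"
      using t M B by (intro mult_right_mono) (auto simp: field_simps)
    also have "\<dots> = 1 / 100" using B by (simp add: exp_minus)
    finally have e: "entropy_on Om pw ?h \<le> 1 / 100" .
    have "(\<Sum>S\<in>Om. pw S * \<bar>?h S - 1\<bar>)\<^sup>2 \<le> 4 * entropy_on Om pw ?h"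
      using finOm pw_pos sum_pw iter_nonneg[OF d] m1[unfolded mean_def]
      by (intro l1_le_entropy) (auto simp: less_imp_le)
    also have "\<dots> \<le> (1 / 5)\<^sup>2" using e by (simp add: power2_eq_square)
    finally have "mean (\<lambda>S. \<bar>?h S - 1\<bar>) \<le> 1 / 5"
      unfolding mean_def by (rule power2_le_imp_le) simp
    thus ?thesis using tv_le_l1[OF x, of t] by linarith
  qed
  hence "(SUP x \<in> kcip_configs V. tv_dist (kcip_law V adj p x t) (kcip_stationary V p)) \<le> 1 / 5"
    by (intro cSUP_least configs_ne)
  thus ?thesis by simp
qed

section \<open>Lower bounds from the slow decay of autocorrelations\<close>

lemma prob_diff_le_tv:
  "measure_pmf.prob \<mu> A - measure_pmf.prob \<nu> A \<le> tv_dist \<mu> \<nu>"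
  unfolding tv_dist_def
proof (rule cSUP_upper)
  have "measure_pmf.prob \<mu> A - measure_pmf.prob \<nu> A \<le> 1" for A
    using measure_pmf.prob_le_1[of \<mu> A] measure_nonneg[of \<nu> A] by linarith
  thus "bdd_above (range (\<lambda>A. measure_pmf.prob \<mu> A - measure_pmf.prob \<nu> A))"
    by (intro bdd_aboveI[of _ 1]) auto
qed simp

text \<open>\<open>tv_dist\<close> is a one-sided supremum, so the complement of the event is
  inserted to bound its probability from below.\<close>

lemma iter_ge_if_mixed:
  assumes mix: "(SUP x \<in> kcip_configs V. tv_dist (kcip_law V adj p x t) (kcip_stationary V p)) < 1 / 4"
    and S: "S \<in> Om"
  shows "mean (indicator B) - 1 / 4 \<le> (step ^^ t) (indicator B) S"
proof -
  define A where "A = {y. supp y \<in> B}"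
  define I where "I S = (indicator A (ind S) :: real)" for S
  have I: "I T = indicator B T" if "T \<in> Om" for T
    using that by (auto simp: I_def A_def indicator_def Om_def supp_ind)
  let ?x = "ind S"
  have x: "?x \<in> kcip_configs V" using S by (rule ind_configs)
  have "tv_dist (kcip_law V adj p ?x t) (kcip_stationary V p)
    \<le> (SUP x \<in> kcip_configs V. tv_dist (kcip_law V adj p x t) (kcip_stationary V p))"
    using finite_kcip_configs[OF finV] by (intro cSUP_upper[OF x]) simp
  hence "tv_dist (kcip_law V adj p ?x t) (kcip_stationary V p) < 1 / 4"
    using mix by linarith
  hence "measure_pmf.prob (kcip_law V adj p ?x t) (- A) - measure_pmf.prob (kcip_stationary V p) (- A) < 1 / 4"
    using prob_diff_le_tv order_le_less_trans by blast
  hence "measure_pmf.prob (kcip_stationary V p) A - measure_pmf.prob (kcip_law V adj p ?x t) A < 1 / 4"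
    using measure_pmf.prob_compl[of A "kcip_law V adj p ?x t"] measure_pmf.prob_compl[of A "kcip_stationary V p"]
    by (simp add: Compl_eq_Diff_UNIV)
  hence "mean I - (step ^^ t) I S < 1 / 4"
    using prob_kcip_law[OF x, of t A] S unfolding prob_kcip_stationary
    by (simp add: I_def[abs_def] supp_ind Om_def)
  moreover have "mean I = mean (indicator B)" unfolding mean_def using I by simp
  moreover have "(step ^^ t) I S = (step ^^ t) (indicator B) S"
    unfolding iter_eq_mean[OF S] mean_def using I by simp
  ultimately show ?thesis by simp
qed

text \<open>For reversible chains with nonnegative spectrum the autocorrelation \<open>a\<close> is
  convex in time, so its drop over t steps is at most t times the first drop, which is the Dirichlet
  form per step.\<close>

lemma autocorrelation_drop:
  "mean (\<lambda>S. (F S)\<^sup>2) - mean (\<lambda>S. F S * (step ^^ t) F S) \<le> t * (dir F / card V)"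
proof -
  define a where "a s = mean (\<lambda>S. F S * (step ^^ s) F S)" for s
  define G where "G S = F S - step F S" for S
  \<comment> \<open>Even exponents give a squared norm after moving half the steps across; odd ones
    leave one step over, which is why \<open>step_psd\<close> is needed.\<close>
  have psd: "0 \<le> mean (\<lambda>S. G S * (step ^^ s) G S)" for s
  proof -
    obtain m where "s = m + m \<or> s = m + Suc m"
      by (metis add_Suc_right evenE mult_2 oddE Suc_eq_plus1 add.assoc)
    thus ?thesis
    proof
      assume s: "s = m + m"
      have "mean (\<lambda>S. G S * (step ^^ s) G S) = mean (\<lambda>S. (step ^^ m) G S * (step ^^ m) G S)"
        unfolding s funpow_add iter_adjoint by simp
      thus ?thesis by (simp add: mean_nonneg)
    next
      assume s: "s = m + Suc m"
      have "mean (\<lambda>S. G S * (step ^^ s) G S) = mean (\<lambda>S. (step ^^ m) G S * step ((step ^^ m) G) S)"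
        unfolding s funpow_add iter_adjoint by simp
      thus ?thesis by (simp add: step_psd)
    qed
  qed
  have G': "G = (\<lambda>S. F S - step F S)" by (rule ext) (rule G_def)
  have Gs: "(step ^^ s) G = (\<lambda>S. (step ^^ s) F S - (step ^^ Suc s) F S)" for s
    unfolding G' iter_diff by (simp add: funpow_swap1)
  have convex: "a (Suc s) - a (Suc (Suc s)) \<le> a s - a (Suc s)" for s
  proof -
    have 1: "mean (\<lambda>S. G S * (step ^^ s) G S) = mean (\<lambda>S. F S * (step ^^ s) G S) - mean (\<lambda>S. step F S * (step ^^ s) G S)"
      unfolding mean_diff[symmetric] by (simp add: G_def left_diff_distrib)
    have 2: "mean (\<lambda>S. step F S * (step ^^ s) G S) = mean (\<lambda>S. F S * (step ^^ Suc s) G S)"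
      by (simp add: step_adjoint)
    have 3: "mean (\<lambda>S. F S * (step ^^ r) G S) = a r - a (Suc r)" for r
      unfolding Gs a_def mean_diff[symmetric] by (simp add: right_diff_distrib)
    show ?thesis using psd[of s] unfolding 1 2 3 by linarith
  qed
  have "a s - a (Suc s) \<le> a 0 - a 1" for s
  proof (induction s)
    case (Suc s)
    thus ?case using convex[of s] by linarith
  qed simp
  hence "a 0 - a t \<le> t * (a 0 - a 1)"
  proof (induction t)
    case (Suc t)
    have "a t - a (Suc t) \<le> a 0 - a 1" by (rule Suc.prems)
    with Suc.IH[OF Suc.prems] have "a 0 - a (Suc t) \<le> real t * (a 0 - a 1) + (a 0 - a 1)" by linarith
    thus ?case by (simp add: algebra_simps)
  qed simp
  also have "a 0 - a 1 = dir F / card V"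
    using mean_square_minus_step[of F] by (simp add: a_def power2_eq_square)
  finally show ?thesis by (simp add: a_def power2_eq_square)
qed

text \<open>Start in equilibrium. From every state of \<open>A\<close> a mixed chain is in
  \<open>B\<close> at time t with probability at least 1/2 - 1/4, and F has then moved by at least
  d. The mean squared displacement of F is twice the drop in autocorrelation, whence 8 = 4 *
  2.\<close>

lemma mixing_lower:
  assumes mix: "(SUP x \<in> kcip_configs V. tv_dist (kcip_law V adj p x t) (kcip_stationary V p)) < 1 / 4"
    and half: "1 / 2 \<le> mean (indicator B)" and "0 \<le> d"
    and sep: "\<And>S T. S \<in> A \<Longrightarrow> T \<in> B \<Longrightarrow> d \<le> F T - F S"
  shows "d\<^sup>2 * mean (indicator A) \<le> 8 * real t * (dir F / card V)"
proof -
  have pt: "d\<^sup>2 * (indicator A S * (step ^^ t) (indicator B) S)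
     \<le> (step ^^ t) (\<lambda>T. (F T)\<^sup>2) S - 2 * (F S * (step ^^ t) F S) + (F S)\<^sup>2" for S
  proof -
    have "(\<lambda>T. (F T - F S)\<^sup>2) = (\<lambda>T. ((F T)\<^sup>2 - (2 * F S) * F T) + (F S)\<^sup>2)"
      by (rule ext) (simp add: power2_diff)
    hence e: "(step ^^ t) (\<lambda>T. (F T - F S)\<^sup>2) S = (step ^^ t) (\<lambda>T. (F T)\<^sup>2) S - 2 * (F S * (step ^^ t) F S) + (F S)\<^sup>2"
      by (simp only: iter_add iter_diff iter_cmult iter_const mult.assoc)
    have "(step ^^ t) (\<lambda>T. (d\<^sup>2 * indicator A S) * indicator B T) S \<le> (step ^^ t) (\<lambda>T. (F T - F S)\<^sup>2) S"
      using sep \<open>0 \<le> d\<close> by (intro iter_mono) (auto simp: indicator_def intro!: power_mono)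
    thus ?thesis unfolding e iter_cmult by (simp add: mult.assoc)
  qed
  have "d\<^sup>2 * (mean (indicator A) * (1 / 4)) = mean (\<lambda>S. d\<^sup>2 * (indicator A S * (1 / 4)))"
    using mean_divide[of "indicator A" 4] mean_cmult[of "d\<^sup>2" "\<lambda>S. indicator A S / 4"] by simp
  also have "\<dots> \<le> mean (\<lambda>S. (step ^^ t) (\<lambda>T. (F T)\<^sup>2) S - 2 * (F S * (step ^^ t) F S) + (F S)\<^sup>2)"
  proof (rule mean_mono)
    fix S assume "S \<in> Om"
    hence "1 / 4 \<le> (step ^^ t) (indicator B) S" using iter_ge_if_mixed[OF mix, of S B] half by linarith
    hence "d\<^sup>2 * (indicator A S * (1 / 4)) \<le> d\<^sup>2 * (indicator A S * (step ^^ t) (indicator B) S)"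
      by (intro mult_left_mono) auto
    thus "d\<^sup>2 * (indicator A S * (1 / 4)) \<le> (step ^^ t) (\<lambda>T. (F T)\<^sup>2) S - 2 * (F S * (step ^^ t) F S) + (F S)\<^sup>2"
      using pt[of S] by linarith
  qed
  also have "\<dots> = 2 * (mean (\<lambda>S. (F S)\<^sup>2) - mean (\<lambda>S. F S * (step ^^ t) F S))"
    by (simp add: mean_add mean_diff mean_cmult mean_iter)
  also have "\<dots> \<le> 2 * (t * (dir F / card V))" using autocorrelation_drop[of F t] by simp
  finally show ?thesis by simp
qed

end

section \<open>Test functions on the torus\<close>

context kcip_graph
begin

text \<open>A legal flip at v needs an occupied neighbour, of probability p for each of at most
  \<open>\<Delta>\<close> candidates, and the conditional variance of F contributes another factor
  p. The weights here are unconditioned, so \<open>Z\<close> remains in the denominator.\<close>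

lemma dir_le_lipschitz:
  assumes \<Delta>: "\<And>b. b \<in> V \<Longrightarrow> card {a \<in> V. adj a b} \<le> \<Delta>"
    and F: "\<And>v S. v \<in> V \<Longrightarrow> S \<subseteq> V \<Longrightarrow> con v S \<Longrightarrow> \<bar>F (insert v S) - F S\<bar> \<le> 1"
  shows "dir F / card V \<le> real \<Delta> * p\<^sup>2 / Z"
proof -
  have "(\<Sum>S\<in>Pow (V - {v}). if con v S then wt_off v S * (p * (1 - p) * (F (insert v S) - F S)\<^sup>2) else 0)
    \<le> real \<Delta> * p\<^sup>2" if v: "v \<in> V" for v
  proof -
    let ?N = "{u \<in> V. adj u v}"
    have "(\<Sum>S\<in>Pow (V - {v}). if con v S then wt_off v S * (p * (1 - p) * (F (insert v S) - F S)\<^sup>2) else 0)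
      \<le> (\<Sum>S\<in>Pow (V - {v}). \<Sum>u\<in>?N. p * (wt_off v S * indicator {S. u \<in> S} S))"
    proof (intro sum_mono)
      fix S assume S: "S \<in> Pow (V - {v})"
      have nn: "0 \<le> p * (wt_off v S * indicator {S. u \<in> S} S)" for u
        using p_pos wt_pos(2)[of v S] by simp
      show "(if con v S then wt_off v S * (p * (1 - p) * (F (insert v S) - F S)\<^sup>2) else 0)
        \<le> (\<Sum>u\<in>?N. p * (wt_off v S * indicator {S. u \<in> S} S))"
      proof (cases "con v S")
        case True
        then obtain u where u: "u \<in> S" "adj u v" by (auto simp: con_def)
        have "(F (insert v S) - F S)\<^sup>2 \<le> 1"
          using square_le_if_abs_le[OF F[OF v _ True]] S by auto
        hence "p * (1 - p) * (F (insert v S) - F S)\<^sup>2 \<le> p * 1 * 1"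
          using p_pos p_less by (intro mult_mono) auto
        hence "wt_off v S * (p * (1 - p) * (F (insert v S) - F S)\<^sup>2) \<le> wt_off v S * p"
          using wt_pos(2)[of v S] by (intro mult_left_mono) auto
        also have "\<dots> = p * (wt_off v S * indicator {S. u \<in> S} S)" using u by simp
        also have "\<dots> \<le> (\<Sum>u\<in>?N. p * (wt_off v S * indicator {S. u \<in> S} S))"
          using u S finV nn by (intro member_le_sum) auto
        finally show ?thesis using True by simp
      qed (use nn in \<open>simp add: sum_nonneg\<close>)
    qed
    also have "\<dots> = (\<Sum>u\<in>?N. \<Sum>S\<in>Pow (V - {v}). p * (wt_off v S * indicator {S. u \<in> S} S))"
      by (rule sum.swap)
    also have "\<dots> = (\<Sum>u\<in>?N. p * p)"
    proof (intro sum.cong refl)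
      fix u assume "u \<in> ?N"
      hence u: "u \<in> V - {v}" using adj_irrefl by auto
      have "(\<Sum>S\<in>Pow (V - {v}). wt_off v S * indicator {S. u \<in> S} S) =
        (\<Sum>S\<in>Pow (V - {v} - {u}). bernoulli_weight (V - {v} - {u}) p S * p)"
        unfolding sum_bernoulli_split[OF finite_Diff[OF finV] u]
        by (intro sum.cong refl) (auto simp: indicator_def)
      also have "\<dots> = p" using sum_bernoulli[of "V - {v} - {u}" p] finV
        by (simp flip: sum_distrib_right)
      finally show "(\<Sum>S\<in>Pow (V - {v}). p * (wt_off v S * indicator {S. u \<in> S} S)) = p * p"
        by (simp flip: sum_distrib_left)
    qed
    also have "\<dots> \<le> real \<Delta> * p\<^sup>2"
      using \<Delta>[OF v] p_pos by (simp add: power2_eq_square mult_right_mono)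
    finally show ?thesis .
  qed
  hence "dir F \<le> (\<Sum>v\<in>V. real \<Delta> * p\<^sup>2) / Z"
    unfolding dir_def using Z_pos by (intro divide_right_mono sum_mono) auto
  thus ?thesis using card_pos by (simp add: field_simps)
qed

lemma dir_nonneg: "0 \<le> dir F"
proof -
  have "0 \<le> wt_off v S * (p * (1 - p) * x\<^sup>2)" for v S x
    using wt_pos(2)[of v S] p_pos p_less by (intro mult_nonneg_nonneg) auto
  thus ?thesis unfolding dir_def using Z_pos by (intro divide_nonneg_pos sum_nonneg) auto
qed

definition top_value :: "('v \<Rightarrow> real) \<Rightarrow> 'v set \<Rightarrow> real" where
  "top_value \<phi> S = Max (\<phi> ` S)"

text \<open>The occupied neighbour that makes the flip legal already forces the maximum to be at
  least \<open>\<phi> v - 1\<close>.\<close>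

lemma top_value_lipschitz:
  assumes "\<And>u v. adj u v \<Longrightarrow> \<bar>\<phi> u - \<phi> v\<bar> \<le> 1" and "v \<in> V" "S \<subseteq> V" "con v S"
  shows "\<bar>top_value \<phi> (insert v S) - top_value \<phi> S\<bar> \<le> 1"
proof -
  obtain u where u: "u \<in> S" "adj u v" using assms by (auto simp: con_def)
  have fin: "finite S" using assms finV finite_subset by blast
  have "\<phi> u \<le> top_value \<phi> S" unfolding top_value_def using u fin by simp
  moreover have "top_value \<phi> (insert v S) = max (\<phi> v) (top_value \<phi> S)"
    unfolding top_value_def image_insert using fin u by (subst Max_insert) auto
  ultimately show ?thesis using assms(1)[OF u(2)] by linarith
qed

lemma mean_singletons_ge:
  assumes W: "W \<subseteq> V"
  shows "real (card W) * (p * (1 - p) ^ card V) \<le> mean (indicator ((\<lambda>w. {w}) ` W))"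
proof -
  have inj: "inj_on (\<lambda>w. {w}) W" by (auto simp: inj_on_def)
  have Z1: "Z \<le> 1" using p_less by (simp add: Z_def)
  have "real (card W) * (p * (1 - p) ^ card V) = (\<Sum>w\<in>W. p * (1 - p) ^ card V)" by simp
  also have "\<dots> \<le> (\<Sum>w\<in>W. pw {w})"
  proof (intro sum_mono)
    fix w assume "w \<in> W"
    hence w: "w \<in> V" using W by auto
    have "p * (1 - p) ^ card V \<le> p * (1 - p) ^ (card V - 1)"
      using p_pos p_less by (intro mult_left_mono power_decreasing) auto
    also have "\<dots> = wt {w}"
    proof -
      have "(\<Prod>v\<in>V - {w}. if v \<in> {w} then p else 1 - p) = (\<Prod>v\<in>V - {w}. 1 - p)"
        by (intro prod.cong) auto
      thus ?thesis unfolding bernoulli_weight_def using finV w by (simp add: prod.remove[of V w])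
    qed
    also have "\<dots> \<le> pw {w}"
      unfolding pw_def using wt_pos(1)[of "{w}"] Z1 Z_pos by (simp add: field_simps)
    finally show "p * (1 - p) ^ card V \<le> pw {w}" .
  qed
  also have "\<dots> = (\<Sum>S\<in>(\<lambda>w. {w}) ` W. pw S)" by (simp add: sum.reindex[OF inj])
  also have "\<dots> = (\<Sum>S\<in>(\<lambda>w. {w}) ` W. pw S * indicator ((\<lambda>w. {w}) ` W) S)" by simp
  also have "\<dots> \<le> mean (indicator ((\<lambda>w. {w}) ` W))"
    unfolding mean_def using finOm W pw_pos
    by (intro sum_mono2) (auto simp: Om_def less_imp_le)
  finally show ?thesis .
qed

text \<open>Deliberately crude: each site has weight at least p(1 - p), and ln x <= x. For p = c/n
  the bound is of order n^2, which suffices because only its logarithm enters the mixing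
  time.\<close>

lemma ln_inverse_pw_le:
  "ln (1 / pw S) \<le> real (card V) * (1 / p + 1 / (1 - p))"
proof -
  have Z1: "Z \<le> 1" using p_less by (simp add: Z_def)
  have "(p * (1 - p)) ^ card V = (\<Prod>v\<in>V. p * (1 - p))" by simp
  also have "\<dots> \<le> wt S"
    unfolding bernoulli_weight_def
  proof (intro prod_mono)
    fix v
    have "p * (1 - p) \<le> p * 1" "p * (1 - p) \<le> 1 * (1 - p)"
      using p_pos p_less by simp_all
    thus "0 \<le> p * (1 - p) \<and> p * (1 - p) \<le> (if v \<in> S then p else 1 - p)"
      using p_pos p_less by auto
  qed
  also have "\<dots> \<le> pw S"
    unfolding pw_def using wt_pos(1)[of S] Z1 Z_pos by (simp add: field_simps)
  finally have "ln ((p * (1 - p)) ^ card V) \<le> ln (pw S)"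
    using p_pos p_less pw_pos[of S] by (subst ln_le_cancel_iff) auto
  hence "ln (1 / pw S) \<le> real (card V) * (ln (1 / p) + ln (1 / (1 - p)))"
  proof -
    have "ln (p * (1 - p)) = ln p + ln (1 - p)" using p_pos p_less by (intro ln_mult_pos) auto
    moreover have "ln ((p * (1 - p)) ^ card V) = real (card V) * ln (p * (1 - p))"
      by (rule ln_realpow)
    ultimately show ?thesis using \<open>ln ((p * (1 - p)) ^ card V) \<le> ln (pw S)\<close> p_pos p_less pw_pos[of S]
      by (simp add: ln_div distrib_left right_diff_distrib)
  qed
  also have "\<dots> \<le> real (card V) * (1 / p + 1 / (1 - p))"
    using ln_le_minus_one[of "1 / p"] ln_le_minus_one[of "1 / (1 - p)"] p_pos p_less
    by (intro mult_left_mono) auto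
  finally show ?thesis .
qed

end

section \<open>Geometry of the torus and of the cycle of first coordinates\<close>

lemma torus_adjE:
  assumes "torus_adj L u v"
  obtains i j where "(i, j) \<in> {(1, 0), (-1, 0), (0, 1), (0, -1)}" "i \<in> {-1, 0, 1}"
    "[fst u - fst v = i] (mod int L)" "[snd u - snd v = j] (mod int L)"
proof -
  from assms obtain d where d: "d \<in> {(1, 0), (-1, 0), (0, 1), (0, -1)}"
    "case d of (i, j) \<Rightarrow> [fst u - fst v = i] (mod int L) \<and> [snd u - snd v = j] (mod int L)"
    unfolding torus_adj_def by blast
  obtain i j where dij: "d = (i, j)" by (cases d)
  show thesis by (rule that[of i j]) (use d dij in auto)
qed

lemma torus_adj_sym: "torus_adj L u v \<Longrightarrow> torus_adj L v u"
proof -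
  assume a: "torus_adj L u v"
  have n: "[x - y = d] (mod int L) \<Longrightarrow> [y - x = - d] (mod int L)" for x y d :: int
    using cong_minus_minus_iff[of "x - y" d "int L"] by simp
  obtain i j where ij: "(i, j) \<in> {(1, 0), (-1, 0), (0, 1), (0, -1)}"
    "[fst u - fst v = i] (mod int L)" "[snd u - snd v = j] (mod int L)"
    using a by (blast elim: torus_adjE)
  have "(- i, - j) \<in> {(1, 0), (-1, 0), (0, 1), (0, -1)}" using ij(1) by auto
  moreover have "case (- i, - j) of (i, j) \<Rightarrow> [fst v - fst u = i] (mod int L) \<and> [snd v - snd u = j] (mod int L)"
    using n[OF ij(2)] n[OF ij(3)] by simp
  moreover have "u \<in> torus_verts L" "v \<in> torus_verts L" using a by (simp_all add: torus_adj_def)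
  ultimately show ?thesis unfolding torus_adj_def by blast
qed

lemma torus_degree:
  assumes "b \<in> torus_verts L"
  shows "card {a \<in> torus_verts L. torus_adj L a b} \<le> 4"
proof -
  let ?D = "{(1, 0), (-1, 0), (0, 1), (0, -1)} :: (int \<times> int) set"
  let ?f = "\<lambda>(i, j). ((fst b + i) mod int L, (snd b + j) mod int L)"
  have m: "x = (y + d) mod int L" if "[x - y = d] (mod int L)" "0 \<le> x" "x < int L" for x y d
  proof -
    have "[x - y + y = d + y] (mod int L)" using that(1) by (intro cong_add) auto
    thus ?thesis using that by (simp add: cong_def add.commute)
  qed
  have "{a \<in> torus_verts L. torus_adj L a b} \<subseteq> ?f ` ?D"
  proof
    fix a assume "a \<in> {a \<in> torus_verts L. torus_adj L a b}"
    then obtain i j where ij: "(i, j) \<in> ?D" "[fst a - fst b = i] (mod int L)" "[snd a - snd b = j] (mod int L)"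
      by (blast elim: torus_adjE)
    have a: "0 \<le> fst a" "fst a < int L" "0 \<le> snd a" "snd a < int L"
      using \<open>a \<in> {a \<in> torus_verts L. torus_adj L a b}\<close> by (auto simp: torus_verts_def)
    have "a = ?f (i, j)" using m[OF ij(2) a(1,2)] m[OF ij(3) a(3,4)] by (auto simp: prod_eq_iff)
    thus "a \<in> ?f ` ?D" using ij(1) by (rule image_eqI)
  qed
  hence "card {a \<in> torus_verts L. torus_adj L a b} \<le> card (?f ` ?D)"
    by (intro card_mono) auto
  also have "\<dots> \<le> card ?D" by (intro card_image_le) auto
  also have "\<dots> = 4" by simp
  finally show ?thesis .
qed

text \<open>The graph distance from k to 0 on the cycle of residues modulo L.\<close>

definition cycle_dist :: "int \<Rightarrow> int \<Rightarrow> int" where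
  "cycle_dist L k = min (k mod L) (L - k mod L)"

lemma cycle_dist_Suc:
  assumes "0 < L"
  shows "\<bar>cycle_dist L (k + 1) - cycle_dist L k\<bar> \<le> 1"
proof -
  have r: "0 \<le> k mod L" "k mod L < L" using assms by auto
  have "(k + 1) mod L = (k mod L + 1) mod L" by (simp add: mod_add_left_eq)
  also have "\<dots> = (if k mod L = L - 1 then 0 else k mod L + 1)"
    using r by auto
  finally show ?thesis using r unfolding cycle_dist_def by auto
qed

lemma cycle_dist_cong: "[k = l] (mod L) \<Longrightarrow> cycle_dist L k = cycle_dist L l"
  by (simp add: cycle_dist_def cong_def)

lemma cycle_dist_lipschitz:
  assumes "0 < L" "[k - l = d] (mod L)" "d \<in> {-1, 0, 1}"
  shows "\<bar>cycle_dist L k - cycle_dist L l\<bar> \<le> 1"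
proof -
  have "[k - l + l = d + l] (mod L)" using assms(2) by (intro cong_add) auto
  hence "cycle_dist L k = cycle_dist L (l + d)" by (intro cycle_dist_cong) (simp add: add.commute)
  thus ?thesis using assms(3) cycle_dist_Suc[OF assms(1), of l] cycle_dist_Suc[OF assms(1), of "l - 1"] by auto
qed

text \<open>Triangle inequality on the cycle, for two base points at distance
  \<open>L div 2\<close>.\<close>

lemma cycle_dist_antipodal:
  assumes "2 \<le> L"
  shows "L div 2 \<le> cycle_dist L k + cycle_dist L (k - L div 2)"
proof -
  define r where "r = k mod L"
  define H where "H = L div 2"
  have r: "0 \<le> r" "r < L" using assms by (auto simp: r_def)
  have H: "2 * H \<le> L" "L \<le> 2 * H + 1" by (auto simp: H_def)
  have "(k - H) mod L = (r - H) mod L" by (simp add: r_def mod_diff_left_eq)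
  also have "\<dots> = (if H \<le> r then r - H else r - H + L)"
  proof (cases "H \<le> r")
    case False
    have "(r - H) mod L = (r - H + L) mod L" by simp
    also have "\<dots> = r - H + L" using False r H by (intro mod_pos_pos_trivial) auto
    finally show ?thesis using False by simp
  qed (use r H assms in auto)
  finally show ?thesis using r H unfolding cycle_dist_def H_def[symmetric] r_def[symmetric] by auto
qed

lemma torus_kcip_graph:
  assumes "2 \<le> L" "0 < p" "p < 1"
  shows "kcip_graph (torus_verts L) (torus_adj L) p"
proof
  show "torus_verts L \<noteq> {}" using assms by (simp add: torus_verts_def)
qed (use assms torus_adj_sym torus_adj_irrefl in auto)

text \<open>Summing the resistance bound over the L^2 possible targets gives the constant R of
  \<open>entropy_le_dir\<close>; the degree bound is 4.\<close>

lemma torus_entropy_le_dir: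
  assumes L: "2 \<le> L" and p: "0 < p" "p < 1" and f: "\<And>S. 0 \<le> f S"
  shows "entropy_on (kcip_graph.Om (torus_verts L)) (kcip_graph.pw (torus_verts L) p) f
    \<le> 4 * (9 + 4 * ln (1 / p)) * (real (L ^ 2) * (27 * (1 + ln (real L)))) * 4 / ((1 - p) * p)
      * kcip_graph.dir (torus_verts L) (torus_adj L) p (\<lambda>S. sqrt (f S))"
proof -
  interpret kcip_graph "torus_verts L" "torus_adj L" p by (rule torus_kcip_graph[OF L p])
  have "(\<Sum>v\<in>torus_verts L. (g v - g u)\<^sup>2) \<le> real (L ^ 2) * (27 * (1 + ln (real L))) *
    (\<Sum>a\<in>torus_verts L. \<Sum>b | b \<in> torus_verts L \<and> torus_adj L a b. (g a - g b)\<^sup>2)"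
    if u: "u \<in> torus_verts L" for g u
  proof -
    have "(\<Sum>v\<in>torus_verts L. (g v - g u)\<^sup>2) \<le> (\<Sum>v\<in>torus_verts L. 27 * (1 + ln (real L)) * torus_energy L g)"
      using L u by (intro sum_mono torus_resistance) auto
    thus ?thesis by (simp add: card_torus_verts torus_energy_def mult.assoc)
  qed
  thus ?thesis
    using entropy_le_dir[of "real (L ^ 2) * (27 * (1 + ln (real L)))" 4 f] torus_degree L f by simp
qed

lemma torus_mixing_lower:
  assumes L: "2 \<le> L" and p: "0 < p" "p < 1"
    and mix: "(SUP x \<in> kcip_configs (torus_verts L). tv_dist (kcip_law (torus_verts L) (torus_adj L) p x t)
      (kcip_stationary (torus_verts L) p)) < 1 / 4"
  shows "real (L ^ 2) ^ 2 * (p * (1 - p) ^ (L ^ 2)) * (1 - (1 - p) ^ (L ^ 2)) \<le> 36864 * p\<^sup>2 * real t"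
proof -
  interpret kcip_graph "torus_verts L" "torus_adj L" p by (rule torus_kcip_graph[OF L p])
  define H where "H = int L div 2"
  define \<phi> where "\<phi> s w = real_of_int (cycle_dist (int L) (fst w - s))" for s and w :: "int \<times> int"
  define B where "B s = {S \<in> Om. real_of_int H / 2 \<le> top_value (\<phi> s) S}" for s
  have H: "1 \<le> H" "3 * H \<ge> int L" "4 * (H div 4 + 1) \<ge> H + 1" "2 * H \<le> int L" "2 * H + 1 \<ge> int L"
    using L by (auto simp: H_def)
  have lip: "\<bar>\<phi> s u - \<phi> s v\<bar> \<le> 1" if "torus_adj L u v" for s u v
  proof -
    obtain d where d: "[fst u - fst v = d] (mod int L)" "d \<in> {-1, 0, 1}"
      using \<open>torus_adj L u v\<close> by (blast elim: torus_adjE)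
    have "\<bar>cycle_dist (int L) (fst u - s) - cycle_dist (int L) (fst v - s)\<bar> \<le> 1"
      using L d by (intro cycle_dist_lipschitz[of _ _ _ d]) auto
    thus ?thesis unfolding \<phi>_def by linarith
  qed
  \<comment> \<open>Any particle is at distance at least \<open>H / 2\<close> from one of the base
    points 0 and \<open>H\<close>. Hence one of the two events has probability at least 1/2, without
    an appeal to symmetry or to typical configurations.\<close>
  have "1 \<le> mean (\<lambda>S. indicator (B 0) S + indicator (B H) S)"
  proof -
    have "(1 :: real) \<le> indicator (B 0) S + indicator (B H) S" if S: "S \<in> Om" for S
    proof -
      obtain w where w: "w \<in> S" using S by (auto simp: Om_def)
      have "S \<subseteq> torus_verts L" using S by (simp add: Om_def)
      hence fin: "finite S" by (rule finite_subset) simp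
      have "H \<le> cycle_dist (int L) (fst w) + cycle_dist (int L) (fst w - H)"
        unfolding H_def using L by (intro cycle_dist_antipodal) auto
      hence "real_of_int H / 2 \<le> \<phi> 0 w \<or> real_of_int H / 2 \<le> \<phi> H w"
        unfolding \<phi>_def by simp linarith
      moreover have "\<phi> s w \<le> top_value (\<phi> s) S" for s
        unfolding top_value_def using w fin by simp
      ultimately have "S \<in> B 0 \<or> S \<in> B H" using S unfolding B_def by (auto intro: order_trans)
      thus ?thesis by (auto simp: indicator_def)
    qed
    thus ?thesis using mean_mono[of "\<lambda>_. 1"] by simp
  qed
  hence "1 / 2 \<le> mean (indicator (B 0)) \<or> 1 / 2 \<le> mean (indicator (B H))"
    unfolding mean_add by linarith
  then obtain s where s: "s \<in> {0, H}" and half: "1 / 2 \<le> mean (indicator (B s))" by blast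
  \<comment> \<open>A strip of columns within \<open>H / 4\<close> of the base point. Because s is 0
    or \<open>H\<close>, it fits into the representatives without wrapping round. Single particles
    in it lie \<open>H / 2 - H / 4\<close> below the level defining \<open>B s\<close>.\<close>
  define W where "W = {s..s + H div 4} \<times> {0..<int L}"
  have hd: "H div 4 \<le> H - 1" using H(1) by auto
  have WV: "W \<subseteq> torus_verts L"
    using s H hd unfolding W_def torus_verts_def by auto
  have sep: "real_of_int H / 4 \<le> top_value (\<phi> s) T - top_value (\<phi> s) S"
    if S: "S \<in> (\<lambda>w. {w}) ` W" and T: "T \<in> B s" for S T
  proof -
    obtain w where w: "S = {w}" "w \<in> W" using S by auto
    have "cycle_dist (int L) (fst w - s) \<le> fst w - s"
    proof -
      have "0 \<le> fst w - s" "fst w - s < int L" using w H hd by (auto simp: W_def)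
      thus ?thesis by (simp add: cycle_dist_def)
    qed
    also have "\<dots> \<le> H div 4" using w by (auto simp: W_def)
    finally have "4 * cycle_dist (int L) (fst w - s) \<le> H" by linarith
    hence "\<phi> s w \<le> real_of_int H / 4" unfolding \<phi>_def by linarith
    moreover have "top_value (\<phi> s) S = \<phi> s w" by (simp add: top_value_def w)
    ultimately show ?thesis using T unfolding B_def by auto
  qed
  have "(real_of_int H / 4)\<^sup>2 * mean (indicator ((\<lambda>w. {w}) ` W))
    \<le> 8 * real t * (dir (top_value (\<phi> s)) / card (torus_verts L))"
    using H by (intro mixing_lower[OF mix half _ sep]) auto
  also have "\<dots> \<le> 8 * real t * (real 4 * p\<^sup>2 / Z)"
    using torus_degree lip by (intro mult_left_mono dir_le_lipschitz top_value_lipschitz) auto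
  finally have 1: "(real_of_int H / 4)\<^sup>2 * mean (indicator ((\<lambda>w. {w}) ` W)) \<le> 32 * real t * p\<^sup>2 / Z"
    by simp
  have cW: "real (card W) = real_of_int (H div 4 + 1) * real L"
    using H by (simp add: W_def card_cartesian_product)
  have "real_of_int (int L) \<le> real_of_int (8 * (H div 4 + 1))" using H by (subst of_int_le_iff) linarith
  hence "real L * real L \<le> 8 * real_of_int (H div 4 + 1) * real L"
    by (intro mult_right_mono) auto
  hence W8: "real (L ^ 2) / 8 \<le> real (card W)" unfolding cW
    by (simp add: power2_eq_square algebra_simps)
  have "real_of_int (int L) \<le> real_of_int (3 * H)" using H by (subst of_int_le_iff) linarith
  hence "(real L / 12)\<^sup>2 \<le> (real_of_int H / 4)\<^sup>2" by (intro power_mono) auto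
  hence H2: "real (L ^ 2) / 144 \<le> (real_of_int H / 4)\<^sup>2" by (simp add: power_divide)
  \<comment> \<open>The factors 144 (from H >= L/3) and 8 (from the width of the strip), together
    with the 32 obtained above, multiply to 36864.\<close>
  have "real (L ^ 2) / 144 * (real (L ^ 2) / 8 * (p * (1 - p) ^ (L ^ 2)))
    \<le> (real_of_int H / 4)\<^sup>2 * (real (card W) * (p * (1 - p) ^ (L ^ 2)))"
    using H2 W8 p by (intro mult_mono mult_right_mono) auto
  also have "\<dots> \<le> (real_of_int H / 4)\<^sup>2 * mean (indicator ((\<lambda>w. {w}) ` W))"
    using mean_singletons_ge[OF WV] by (intro mult_left_mono) (auto simp: card_torus_verts)
  also note 1
  finally show ?thesis using Z_pos unfolding Z_def card_torus_verts
    by (simp add: field_simps power2_eq_square)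
qed

section \<open>Mixing time bounds\<close>

lemma power_ge_exp:
  fixes p :: real
  assumes "0 \<le> p" "\<delta> \<le> 1 - p" "0 < \<delta>"
  shows "exp (- (real n * p / \<delta>)) \<le> (1 - p) ^ n"
proof -
  have "1 / (1 - p) = 1 + p / (1 - p)" using assms by (simp add: field_simps)
  also have "\<dots> \<le> 1 + p / \<delta>" using assms by (simp add: frac_le)
  also have "\<dots> \<le> exp (p / \<delta>)" by (rule exp_ge_add_one_self)
  finally have "exp (- (p / \<delta>)) \<le> 1 - p"
    using assms by (simp add: exp_minus field_simps)
  hence "exp (- (p / \<delta>)) ^ n \<le> (1 - p) ^ n" by (intro power_mono) auto
  thus ?thesis by (simp flip: exp_of_nat_mult)
qed

text \<open>The integer n is at least \<open>\<lfloor>c\<rfloor> + 1\<close>, and the worst case is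
  attained there.\<close>

lemma one_minus_ratio_bounded_below:
  assumes "0 < c"
  obtains \<delta> :: real where "0 < \<delta>" "\<And>n :: nat. c < real n \<Longrightarrow> \<delta> \<le> 1 - c / real n"
proof
  define m where "m = nat \<lfloor>c\<rfloor> + 1"
  have m: "c < real m" using assms unfolding m_def by linarith
  show "0 < 1 - c / real m" using m assms by simp
  fix n :: nat assume n: "c < real n"
  hence "\<lfloor>c\<rfloor> < int n" by (simp add: floor_less_iff)
  hence "m \<le> n" unfolding m_def by (simp add: zless_nat_eq_int_zless nat_less_iff assms less_imp_le Suc_le_eq)
  thus "1 - c / real m \<le> 1 - c / real n" using m assms by (simp add: frac_le)
qed

lemma ln_ge_1_of_ge_4: "1 \<le> ln x" if "4 \<le> x" for x :: real
proof -
  have "exp 1 \<le> x" using e_less_272 that by linarith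
  thus ?thesis using that by (subst ln_ge_iff) auto
qed

lemma square_ge_4: "2 \<le> L \<Longrightarrow> 4 \<le> real (L ^ 2)"
  using power_mono[of 2 "real L" 2] by simp

text \<open>Stated for every time at which the chain is mixed, so that it applies to the infimum
  once that is known to be attained.\<close>

lemma kcip_torus_lower:
  assumes c: "0 < c"
  shows "\<exists>C1 > 0. \<forall>L t. 2 \<le> L \<longrightarrow> c < real (L ^ 2) \<longrightarrow>
    (SUP x \<in> kcip_configs (torus_verts L). tv_dist (kcip_law (torus_verts L) (torus_adj L) (c / real (L ^ 2)) x t)
      (kcip_stationary (torus_verts L) (c / real (L ^ 2)))) < 1 / 4 \<longrightarrow> C1 * real (L ^ 2) ^ 3 \<le> real t"
proof -
  obtain \<delta> where \<delta>: "0 < \<delta>" "\<And>n :: nat. c < real n \<Longrightarrow> \<delta> \<le> 1 - c / real n"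
    using one_minus_ratio_bounded_below[OF c] by blast
  \<comment> \<open>Since n p = c, dividing n^2 p (1-p)^n (1 - (1-p)^n) by 36864 p^2 gives n^3 /
    (36864 c) times two factors bounded below in terms of c.\<close>
  define C1 where "C1 = exp (- (c / \<delta>)) * (1 - exp (- c)) / (36864 * c)"
  have C1: "0 < C1" using c by (simp add: C1_def)
  show ?thesis
  proof (intro exI[of _ C1] conjI allI impI C1)
    fix L t assume L: "2 \<le> L" and cn: "c < real (L ^ 2)"
    define n where "n = L ^ 2"
    define p where "p = c / real n"
    assume mix: "(SUP x \<in> kcip_configs (torus_verts L). tv_dist (kcip_law (torus_verts L) (torus_adj L) (c / real (L ^ 2)) x t)
      (kcip_stationary (torus_verts L) (c / real (L ^ 2)))) < 1 / 4"
    have n: "0 < real n" "c < real n" using cn L by (simp_all add: n_def)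
    have p: "0 < p" "p < 1" "\<delta> \<le> 1 - p" using c n \<delta>(2)[OF n(2)] by (simp_all add: p_def)
    have np: "real n * p = c" using n by (simp add: p_def)
    have lo: "exp (- (c / \<delta>)) \<le> (1 - p) ^ n"
      using power_ge_exp[of p \<delta> n] p \<delta> np by simp
    have "(1 - p) ^ n \<le> exp (- p) ^ n"
      using p exp_ge_add_one_self[of "- p"] by (intro power_mono) auto
    also have "\<dots> = exp (- c)" using np by (simp flip: exp_of_nat_mult)
    finally have up: "(1 - p) ^ n \<le> exp (- c)" .
    have "real n ^ 2 * (p * exp (- (c / \<delta>))) * (1 - exp (- c))
      \<le> real n ^ 2 * (p * (1 - p) ^ n) * (1 - (1 - p) ^ n)"
      using lo up p c by (intro mult_mono mult_left_mono) auto
    also have "\<dots> \<le> 36864 * p\<^sup>2 * real t"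
      unfolding n_def using p mix by (intro torus_mixing_lower[OF L]) (auto simp: p_def n_def)
    finally have "real n ^ 2 * (p * exp (- (c / \<delta>))) * (1 - exp (- c)) \<le> 36864 * p\<^sup>2 * real t" .
    moreover have "C1 * real n ^ 3 * (36864 * p\<^sup>2) = real n ^ 2 * (p * exp (- (c / \<delta>))) * (1 - exp (- c))"
    proof -
      have "C1 * real n ^ 3 * (36864 * p\<^sup>2) = C1 * (36864 * (real n * p)) * (real n ^ 2 * p)"
        by (simp add: power2_eq_square power3_eq_cube)
      also have "C1 * (36864 * (real n * p)) = exp (- (c / \<delta>)) * (1 - exp (- c))"
        unfolding np using c by (simp add: C1_def)
      finally show ?thesis by (simp add: mult_ac)
    qed
    ultimately have "C1 * real n ^ 3 * (36864 * p\<^sup>2) \<le> real t * (36864 * p\<^sup>2)"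
      by (simp add: mult_ac)
    hence "C1 * real n ^ 3 \<le> real t" using p by (subst (asm) mult_le_cancel_right_pos) auto
    thus "C1 * real (L ^ 2) ^ 3 \<le> real t" by (simp only: n_def)
  qed
qed

lemma kcip_torus_upper:
  assumes c: "0 < c"
  shows "\<exists>C2 > 0. \<forall>L. 2 \<le> L \<longrightarrow> c < real (L ^ 2) \<longrightarrow> (\<exists>t > 0.
    (SUP x \<in> kcip_configs (torus_verts L). tv_dist (kcip_law (torus_verts L) (torus_adj L) (c / real (L ^ 2)) x t)
      (kcip_stationary (torus_verts L) (c / real (L ^ 2)))) < 1 / 4 \<and>
    real t \<le> C2 * real (L ^ 2) ^ 3 * ln (real (L ^ 2)) ^ 3)"
proof -
  obtain \<delta> where \<delta>: "0 < \<delta>" "\<And>n :: nat. c < real n \<Longrightarrow> \<delta> \<le> 1 - c / real n"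
    using one_minus_ratio_bounded_below[OF c] by blast
  \<comment> \<open>864 = 4 * 27 * 4 * 2, the last 2 from 1 + ln L <= 2 ln n, and 13 = 9 + 4 from ln
    n >= 1. The final 1 ensures that the relaxation time \<open>M\<close> is at least 1.\<close>
  define C3 where "C3 = 864 * (13 + 4 * \<bar>ln c\<bar>) / (c * \<delta>) + 1"
  define C4 where "C4 = 1 / c + 1 / \<delta>"
  define C5 where "C5 = \<bar>ln (100 * C4)\<bar> + 2"
  have pos: "1 \<le> C3" "0 < C4" "2 \<le> C5" using c \<delta> by (simp_all add: C3_def C4_def C5_def add_pos_pos)
  show ?thesis
  proof (intro exI[of _ "C3 * C5 + 2"] conjI allI impI)
    show "0 < C3 * C5 + 2" using pos by (simp add: add_nonneg_pos)
    fix L assume L: "2 \<le> L" and cn: "c < real (L ^ 2)"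
    define n where "n = L ^ 2"
    define p where "p = c / real n"
    define l where "l = ln (real n)"
    define M where "M = C3 * real n ^ 3 * l ^ 2"
    \<comment> \<open>The added 1 makes t positive, as the mixing time requires; with the rounding
      it accounts for the 2 in the final constant.\<close>
    define t where "t = nat \<lceil>M * ln (100 * (C4 * (real n)\<^sup>2))\<rceil> + 1"
    have n: "0 < real n" "c < real n" "4 \<le> real n" using cn L square_ge_4[OF L] by (simp_all add: n_def)
    have p: "0 < p" "p < 1" "\<delta> \<le> 1 - p" using c n \<delta>(2)[OF n(2)] by (simp_all add: p_def)
    have l: "1 \<le> l" unfolding l_def using n by (intro ln_ge_1_of_ge_4)
    interpret kcip_graph "torus_verts L" "torus_adj L" p by (rule torus_kcip_graph[OF L p(1,2)])
    have cV: "card (torus_verts L) = n" by (simp add: card_torus_verts n_def)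
    have n1: "1 \<le> real n ^ 3" using n by (intro one_le_power) simp
    have M1: "1 \<le> M"
    proof -
      have "1 * 1 * 1 \<le> C3 * real n ^ 3 * l ^ 2"
        using pos n1 l by (intro mult_mono) auto
      thus ?thesis by (simp add: M_def)
    qed
    have C: "entropy_on Om pw f \<le> M * (dir (\<lambda>S. sqrt (f S)) / card (torus_verts L))"
      if f: "\<And>S. 0 \<le> f S" for f
    proof -
      have "ln (1 / p) = l - ln c" using c n by (simp add: p_def l_def ln_div)
      also have "\<dots> \<le> l + \<bar>ln c\<bar> * l"
        using l mult_left_mono[of 1 l "\<bar>ln c\<bar>"] by linarith
      finally have "9 + 4 * ln (1 / p) \<le> 9 * l + 4 * (l + \<bar>ln c\<bar> * l)"
        using l by (intro add_mono mult_left_mono) auto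
      hence 1: "9 + 4 * ln (1 / p) \<le> (13 + 4 * \<bar>ln c\<bar>) * l" by (simp add: algebra_simps)
      have "ln (real L) * 2 = l" unfolding l_def n_def using L by (simp add: ln_realpow)
      hence 2: "1 + ln (real L) \<le> 2 * l" using l by linarith
      have "4 * (9 + 4 * ln (1 / p)) * (real (L ^ 2) * (27 * (1 + ln (real L)))) * 4 / ((1 - p) * p)
        \<le> 4 * ((13 + 4 * \<bar>ln c\<bar>) * l) * (real n * (27 * (2 * l))) * 4 / (\<delta> * p)"
        using 1 2 p \<delta> l L n unfolding n_def[symmetric]
        by (intro frac_le mult_mono mult_nonneg_nonneg add_nonneg_nonneg) (auto intro: order_trans)
      also have "\<dots> = (864 * (13 + 4 * \<bar>ln c\<bar>) / (c * \<delta>)) * (real n ^ 2 * l ^ 2)"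
        using c \<delta> n by (simp add: p_def field_simps power2_eq_square)
      also have "\<dots> \<le> C3 * (real n ^ 2 * l ^ 2)"
        by (intro mult_right_mono) (auto simp: C3_def)
      also have "\<dots> = M / n" using n by (simp add: M_def power2_eq_square power3_eq_cube)
      finally have "4 * (9 + 4 * ln (1 / p)) * (real (L ^ 2) * (27 * (1 + ln (real L)))) * 4 / ((1 - p) * p) \<le> M / n" .
      from mult_right_mono[OF this dir_nonneg[of "\<lambda>S. sqrt (f S)"]]
      have "entropy_on Om pw f \<le> M / n * dir (\<lambda>S. sqrt (f S))"
        using torus_entropy_le_dir[where f = f, OF L p(1,2) f] by (rule order_trans[rotated])
      thus ?thesis by (simp add: cV)
    qed
    have B: "ln (1 / pw S) \<le> C4 * (real n)\<^sup>2" for S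
    proof -
      have "1 / (1 - p) \<le> 1 / \<delta>" using p \<delta> by (simp add: frac_le)
      also have "\<dots> \<le> 1 / \<delta> * real n" using \<delta> n mult_left_mono[of 1 "real n" "1 / \<delta>"] by simp
      finally have "1 / p + 1 / (1 - p) \<le> C4 * real n"
        using c by (simp add: C4_def p_def distrib_right)
      hence "real n * (1 / p + 1 / (1 - p)) \<le> real n * (C4 * real n)" by (intro mult_left_mono) auto
      thus ?thesis using ln_inverse_pw_le[of S] unfolding cV by (simp add: power2_eq_square mult_ac)
    qed
    have B0: "0 < C4 * (real n)\<^sup>2" using pos n by simp
    have "M * ln (100 * (C4 * (real n)\<^sup>2)) \<le> real t" unfolding t_def by linarith
    hence mix: "(SUP x \<in> kcip_configs (torus_verts L). tv_dist (kcip_law (torus_verts L) (torus_adj L) p x t)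
      (kcip_stationary (torus_verts L) p)) < 1 / 4"
      by (intro mixed_if_entropy[OF C M1 B B0])
    have "ln (100 * (C4 * (real n)\<^sup>2)) = ln (100 * C4) + 2 * l"
    proof -
      have "ln (100 * C4 * (real n)\<^sup>2) = ln (100 * C4) + ln ((real n)\<^sup>2)"
        using pos n by (intro ln_mult_pos) auto
      also have "ln ((real n)\<^sup>2) = 2 * l" using n by (simp add: l_def ln_realpow)
      finally show ?thesis by (simp only: mult.assoc)
    qed
    also have "\<dots> \<le> C5 * l"
      using l mult_left_mono[of 1 l "\<bar>ln (100 * C4)\<bar>"] unfolding C5_def distrib_right by linarith
    finally have "M * ln (100 * (C4 * (real n)\<^sup>2)) \<le> M * (C5 * l)" using M1 by (intro mult_left_mono) auto
    also have "\<dots> = C3 * C5 * real n ^ 3 * l ^ 3" by (simp add: M_def power2_eq_square power3_eq_cube)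
    finally have m: "M * ln (100 * (C4 * (real n)\<^sup>2)) \<le> C3 * C5 * real n ^ 3 * l ^ 3" .
    have "1 * 1 \<le> real n ^ 3 * l ^ 3" using n1 l by (intro mult_mono) auto
    hence "2 \<le> 2 * real n ^ 3 * l ^ 3" by simp
    moreover have "0 \<le> C3 * C5 * real n ^ 3 * l ^ 3" using pos n l by simp
    hence "real t \<le> C3 * C5 * real n ^ 3 * l ^ 3 + 2"
      using m unfolding t_def by linarith
    ultimately have "real t \<le> (C3 * C5 + 2) * real n ^ 3 * l ^ 3"
      by (simp add: distrib_right)
    thus "\<exists>t > 0. (SUP x \<in> kcip_configs (torus_verts L). tv_dist (kcip_law (torus_verts L) (torus_adj L) (c / real (L ^ 2)) x t)
      (kcip_stationary (torus_verts L) (c / real (L ^ 2)))) < 1 / 4 \<and>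
      real t \<le> (C3 * C5 + 2) * real (L ^ 2) ^ 3 * ln (real (L ^ 2)) ^ 3"
      using mix unfolding p_def n_def l_def by (intro exI[of _ t]) (simp add: t_def)
  qed
qed

theorem theorem1:
  fixes c :: real
  assumes "0 < c"
  shows "\<exists>C1 C2 :: real. 0 < C1 \<and> 0 < C2 \<and>
    (\<forall>L n :: nat. L \<ge> 2 \<longrightarrow> n = L ^ 2 \<longrightarrow> real n > c \<longrightarrow>
      C1 * real n ^ 3 \<le> real (kcip_mixing_time (torus_verts L) (torus_adj L) (c / real n)) \<and>
      real (kcip_mixing_time (torus_verts L) (torus_adj L) (c / real n))
        \<le> C2 * real n ^ 3 * ln (real n) ^ 14)"
proof -
  obtain C1 where C1: "0 < C1" and low: "\<And>L t. 2 \<le> L \<Longrightarrow> c < real (L ^ 2) \<Longrightarrow>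
    (SUP x \<in> kcip_configs (torus_verts L). tv_dist (kcip_law (torus_verts L) (torus_adj L) (c / real (L ^ 2)) x t)
      (kcip_stationary (torus_verts L) (c / real (L ^ 2)))) < 1 / 4 \<Longrightarrow> C1 * real (L ^ 2) ^ 3 \<le> real t"
    using kcip_torus_lower[OF assms] by metis
  obtain C2 where C2: "0 < C2" and up: "\<And>L. 2 \<le> L \<Longrightarrow> c < real (L ^ 2) \<Longrightarrow> (\<exists>t > 0.
    (SUP x \<in> kcip_configs (torus_verts L). tv_dist (kcip_law (torus_verts L) (torus_adj L) (c / real (L ^ 2)) x t)
      (kcip_stationary (torus_verts L) (c / real (L ^ 2)))) < 1 / 4 \<and>
    real t \<le> C2 * real (L ^ 2) ^ 3 * ln (real (L ^ 2)) ^ 3)"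
    using kcip_torus_upper[OF assms] by metis
  show ?thesis
  proof (rule exI[of _ C1], rule exI[of _ C2], intro conjI allI impI C1 C2)
    fix L n :: nat assume L: "2 \<le> L" and n: "n = L ^ 2" and cn: "c < real n"
    define T where "T = {t. t > 0 \<and> (SUP x \<in> kcip_configs (torus_verts L).
      tv_dist (kcip_law (torus_verts L) (torus_adj L) (c / real n) x t) (kcip_stationary (torus_verts L) (c / real n))) < 1 / 4}"
    have mt: "kcip_mixing_time (torus_verts L) (torus_adj L) (c / real n) = Inf T"
      by (simp add: kcip_mixing_time_def kcip_mixing_time_eps_def T_def)
    obtain t where t: "t \<in> T" "real t \<le> C2 * real n ^ 3 * ln (real n) ^ 3"
      using up[OF L] cn unfolding T_def n by blast
    \<comment> \<open>The upper bound supplies an element of \<open>T\<close>, so the infimum is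
      attained and is not the default 0; the lower bound then applies to \<open>Inf T\<close>
      itself.\<close>
    have "Inf T \<in> T" using t(1) by (intro Inf_nat_def1) auto
    thus "C1 * real n ^ 3 \<le> real (kcip_mixing_time (torus_verts L) (torus_adj L) (c / real n))"
      using low[OF L] cn unfolding mt unfolding T_def n by blast
    have "real (Inf T) \<le> real t" using t(1) by (simp add: cInf_lower)
    also note t(2)
    \<comment> \<open>n >= 4 gives ln n >= 1, so the third power obtained may be relaxed to the
      fourteenth.\<close>
    also have "C2 * real n ^ 3 * ln (real n) ^ 3 \<le> C2 * real n ^ 3 * ln (real n) ^ 14"
      using C2 ln_ge_1_of_ge_4[OF square_ge_4[OF L]] unfolding n
      by (intro mult_left_mono power_increasing) auto
    finally show "real (kcip_mixing_time (torus_verts L) (torus_adj L) (c / real n))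
        \<le> C2 * real n ^ 3 * ln (real n) ^ 14" unfolding mt .
  qed
qed

end
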